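(* Suppose there is no (randomized) polynomial-time algorithm that distinguishes between Label Cover instances with $|A|=|B|=n/2$ and all vertices of degree $d$ in which all edges are satisfiable, and such instances in which at most an $s$ fraction of the edges are satisfiable. Then there is a constant $c$ such that for $18\log n\leq\alpha\leq\min\{1/s,\ d^{1/k}/\log|\Sigma_A|\}$ there is no (randomized) polynomial-time algorithm that distinguishes between Label Cover instances with girth larger than $k$ in which all edges are satisfiable and those in which at most a $c/\alpha$ fraction of the edges are satisfiable.
   Context: A Label Cover instance consists of a bipartite graph $(A,B,E)$, finite alphabets $\Sigma_A,\Sigma_B$ (with $|\Sigma_A|\ge|\Sigma_B|$), and for each edge $e$ a nonempty relation $\pi_e\subseteq\Sigma_A\times\Sigma_B$. A labeling assigns a label from $\Sigma_A$ to each vertex of $A$ and from $\Sigma_B$ to each vertex of $B$; an edge $(a,b)$ is satisfied if the pair of labels lies in $\pi_{(a,b)}$. The girth of an instance is the girth of its graph. Here $k\geq 3$ is an integer and logarithms are base 2. *)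

theory Defs
  imports
    "HOL-Probability.Probability_Mass_Function"
    "HOL-Library.Extended_Nat"
    "HOL-Computational_Algebra.Polynomial"
begin

text \<open>
  Randomized algorithms are programs of Jones' WHILE language over binary trees, extended by a
  fair coin flip. Every step allocates a number of tree nodes that is bounded in terms of the
  program alone, and tests only inspect the root of a tree, so counting steps is polynomially
  equivalent to the running time of (probabilistic) Turing machines.
\<close>

datatype data = Atom | Node data data

primrec data_fst :: "data \<Rightarrow> data" where
  "data_fst Atom = Atom"
| "data_fst (Node x y) = x"

primrec data_snd :: "data \<Rightarrow> data" where
  "data_snd Atom = Atom"
| "data_snd (Node x y) = y"

type_synonym store = "nat \<Rightarrow> data"

datatype expr = Var nat | Lit data | Join expr expr | Hd expr | Tl expr

primrec eval_expr :: "expr \<Rightarrow> store \<Rightarrow> data" where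
  "eval_expr (Var x) \<sigma> = \<sigma> x"
| "eval_expr (Lit v) \<sigma> = v"
| "eval_expr (Join e f) \<sigma> = Node (eval_expr e \<sigma>) (eval_expr f \<sigma>)"
| "eval_expr (Hd e) \<sigma> = data_fst (eval_expr e \<sigma>)"
| "eval_expr (Tl e) \<sigma> = data_snd (eval_expr e \<sigma>)"

datatype instr =
    Assign nat expr
  | Flip nat
  | Cond expr "instr list" "instr list"
  | While expr "instr list"

type_synonym config = "instr list \<times> store"

text \<open>\<^term>\<open>Atom\<close> is the truth value false, any other tree is true.\<close>

fun step :: "config \<Rightarrow> config pmf" where
  "step ([], \<sigma>) = return_pmf ([], \<sigma>)"
| "step (Assign x e # is, \<sigma>) = return_pmf (is, \<sigma>(x := eval_expr e \<sigma>))"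
| "step (Flip x # is, \<sigma>) =
     map_pmf (\<lambda>b. (is, \<sigma>(x := (if b then Node Atom Atom else Atom)))) (bernoulli_pmf (1/2))"
| "step (Cond e js ks # is, \<sigma>) =
     return_pmf ((if eval_expr e \<sigma> \<noteq> Atom then js else ks) @ is, \<sigma>)"
| "step (While e js # is, \<sigma>) =
     return_pmf (if eval_expr e \<sigma> \<noteq> Atom then js @ While e js # is else is, \<sigma>)"

primrec run :: "nat \<Rightarrow> config \<Rightarrow> config pmf" where
  "run 0 cfg = return_pmf cfg"
| "run (Suc t) cfg = bind_pmf (step cfg) (run t)"

definition initial :: "instr list \<Rightarrow> data \<Rightarrow> config" where
  "initial P x = (P, (\<lambda>_. Atom)(0 := x))"

definition runs_in_time :: "instr list \<Rightarrow> (nat \<Rightarrow> nat) \<Rightarrow> bool" where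
  "runs_in_time P T \<longleftrightarrow>
     (\<forall>x. \<forall>cfg \<in> set_pmf (run (T (size x)) (initial P x)). fst cfg = [])"

text \<open>
  The result is read from variable 0. Halted configurations are fixed by \<^const>\<open>step\<close>, so for
  programs satisfying \<^term>\<open>runs_in_time P T\<close> the value below does not depend on the
  choice of \<open>T\<close>.
\<close>

definition accept_prob :: "instr list \<Rightarrow> (nat \<Rightarrow> nat) \<Rightarrow> data \<Rightarrow> real" where
  "accept_prob P T x =
     measure_pmf.prob (run (T (size x)) (initial P x)) {cfg. snd cfg 0 \<noteq> Atom}"

text \<open>
  A graph is given by its set of undirected edges \<open>{u, v}\<close>. A cycle is listed without
  repeating its first vertex; the girth of a forest is \<open>\<infinity>\<close>.
\<close>

definition is_cycle :: "'v set set \<Rightarrow> 'v list \<Rightarrow> bool" where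
  "is_cycle G vs \<longleftrightarrow> 3 \<le> length vs \<and> distinct vs \<and>
     (\<forall>i < length vs. {vs ! i, vs ! (Suc i mod length vs)} \<in> G)"

definition girth :: "'v set set \<Rightarrow> enat" where
  "girth G = (INF vs \<in> {vs. is_cycle G vs}. enat (length vs))"

text \<open>
  Up to renaming, the vertex sets are \<open>{..<nA}\<close> and \<open>{..<nB}\<close>, and the alphabets are
  \<open>{..<qA}\<close> and \<open>{..<qB}\<close>.
\<close>

record label_cover =
  nA :: nat
  nB :: nat
  qA :: nat
  qB :: nat
  edges :: "(nat \<times> nat) set"
  rel :: "nat \<times> nat \<Rightarrow> (nat \<times> nat) set"

text \<open>
  An edge is required because fractions of the edge set are meaningless otherwise: an edgeless
  instance would be completely satisfiable and at most \<open>s\<close>-satisfiable at once.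
\<close>

definition wf_label_cover :: "label_cover \<Rightarrow> bool" where
  "wf_label_cover I \<longleftrightarrow>
     edges I \<subseteq> {..<nA I} \<times> {..<nB I} \<and> edges I \<noteq> {} \<and> qB I \<le> qA I \<and>
     (\<forall>e \<in> edges I. rel I e \<noteq> {} \<and> rel I e \<subseteq> {..<qA I} \<times> {..<qB I})"

definition num_vertices :: "label_cover \<Rightarrow> nat" where
  "num_vertices I = nA I + nB I"

definition regular :: "label_cover \<Rightarrow> nat \<Rightarrow> bool" where
  "regular I d \<longleftrightarrow>
     (\<forall>a < nA I. card {b. (a, b) \<in> edges I} = d) \<and>
     (\<forall>b < nB I. card {a. (a, b) \<in> edges I} = d)"

definition lc_girth :: "label_cover \<Rightarrow> enat" where
  "lc_girth I = girth ((\<lambda>(a, b). {Inl a, Inr b}) ` edges I)"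

definition labeling :: "label_cover \<Rightarrow> (nat \<Rightarrow> nat) \<Rightarrow> (nat \<Rightarrow> nat) \<Rightarrow> bool" where
  "labeling I f g \<longleftrightarrow> (\<forall>a < nA I. f a < qA I) \<and> (\<forall>b < nB I. g b < qB I)"

definition satisfied :: "label_cover \<Rightarrow> (nat \<Rightarrow> nat) \<Rightarrow> (nat \<Rightarrow> nat) \<Rightarrow> (nat \<times> nat) set" where
  "satisfied I f g = {(a, b) \<in> edges I. (f a, g b) \<in> rel I (a, b)}"

definition all_satisfiable :: "label_cover \<Rightarrow> bool" where
  "all_satisfiable I \<longleftrightarrow> (\<exists>f g. labeling I f g \<and> satisfied I f g = edges I)"

definition at_most_satisfiable :: "label_cover \<Rightarrow> real \<Rightarrow> bool" where
  "at_most_satisfiable I s \<longleftrightarrow>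
     (\<forall>f g. labeling I f g \<longrightarrow> real (card (satisfied I f g)) / real (card (edges I)) \<le> s)"

primrec enc_nat :: "nat \<Rightarrow> data" where
  "enc_nat 0 = Atom"
| "enc_nat (Suc n) = Node Atom (enc_nat n)"

definition enc_list :: "('a \<Rightarrow> data) \<Rightarrow> 'a list \<Rightarrow> data" where
  "enc_list enc xs = foldr (\<lambda>x. Node (enc x)) xs Atom"

definition enc_nat_pair :: "nat \<times> nat \<Rightarrow> data" where
  "enc_nat_pair = (\<lambda>(m, n). Node (enc_nat m) (enc_nat n))"

text \<open>
  The edges and the relations are written as lists, in any order. Numbers are written in unary:
  the vertices and labels are part of the input, so its length is at least their number.
\<close>

definition encodes :: "data \<Rightarrow> label_cover \<Rightarrow> bool" where
  "encodes x I \<longleftrightarrow> (\<exists>es rs.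
     distinct es \<and> set es = edges I \<and>
     (\<forall>e \<in> edges I. distinct (rs e) \<and> set (rs e) = rel I e) \<and>
     x = Node (enc_nat (nA I)) (Node (enc_nat (nB I)) (Node (enc_nat (qA I)) (Node (enc_nat (qB I))
           (enc_list (\<lambda>e. Node (enc_nat_pair e) (enc_list enc_nat_pair (rs e))) es)))))"

text \<open>
  Bounded two-sided error on all instances with sufficiently many vertices. Without ``sufficiently
  many'', a single small \<open>n\<close> at which the soundness threshold is at least 1 would put the same
  instance on both sides and make indistinguishability trivially true.
\<close>

definition rand_polytime_distinguishable :: "label_cover set \<Rightarrow> label_cover set \<Rightarrow> bool" where
  "rand_polytime_distinguishable Yes No \<longleftrightarrow>
     (\<exists>P (p :: nat poly) \<epsilon> n\<^sub>0. 0 < \<epsilon> \<and> runs_in_time P (poly p) \<and>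
        (\<forall>I x. encodes x I \<and> n\<^sub>0 \<le> num_vertices I \<longrightarrow>
           (I \<in> Yes \<longrightarrow> 1/2 + \<epsilon> \<le> accept_prob P (poly p) x) \<and>
           (I \<in> No \<longrightarrow> accept_prob P (poly p) x \<le> 1/2 - \<epsilon>)))"

text \<open>
  The degree and the alphabet size are functions of the number \<open>n\<close> of vertices. Since
  \<open>n = |A| + |B|\<close>, the first equation says \<open>|A| = |B| = n/2\<close>.
\<close>

definition regular_instances :: "(nat \<Rightarrow> nat) \<Rightarrow> (nat \<Rightarrow> nat) \<Rightarrow> label_cover set" where
  "regular_instances d q =
     {I. wf_label_cover I \<and> nA I = nB I \<and>
         regular I (d (num_vertices I)) \<and> qA I = q (num_vertices I)}"

definition girth_instances :: "nat \<Rightarrow> label_cover set" where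
  "girth_instances k = {I. wf_label_cover I \<and> enat k < lc_girth I}"

end

theory Submission
  imports Defs "HOL-Real_Asymp.Real_Asymp"
begin

text \<open>
  Keep every edge of a \<open>d\<close>-regular instance independently with probability \<open>p = 2 ^ -j\<close>, where
  \<open>p * d\<close> is \<open>d powr (1 / k)\<close> up to a factor depending only on \<open>k\<close>, and then reinsert the kept
  edges one by one, dropping those that would close a cycle of length at most \<open>k\<close>. An edge lies on
  at most \<open>d ^ (m - 2)\<close> cycles of length \<open>m\<close>, so the expected fraction of dropped edges is
  \<open>O ((p * d) ^ (k - 1) / d) = O (d powr (- 1 / k))\<close>. For a fixed labeling that satisfies at most a
  \<open>1 / \<alpha>\<close> fraction of the edges, a Chernoff bound shows that it satisfies more than an \<open>O (1 / \<alpha>)\<close>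
  fraction of the kept edges with probability at most \<open>2 powr (- \<Omega> (n * p * d / \<alpha>))\<close>, which
  beats the union bound over the at most \<open>|\<Sigma>\<^sub>A| ^ n\<close> labelings because
  \<open>\<alpha> * log |\<Sigma>\<^sub>A| \<le> d powr (1 / k)\<close>. The rate \<open>p\<close> depends only on \<open>d\<close> and \<open>k\<close>, so \<open>\<alpha>\<close> and
  \<open>s\<close> need not be computable.

  The program flips all its coins first, in a number of steps that depends only on the input; what
  remains is a deterministic polynomial-time function of the input and the coins.
\<close>

section \<open>Programs with polynomial running time\<close>

text \<open>The assumed hardness is used by contradiction: a distinguisher for large girth is turned
  into one for the regular instances. Sparsification leaves the vertices in place, so both instances
  have the same \<open>n\<close> and \<alpha> is evaluated at the same point. Constraints are only
  discarded, so satisfiability survives, and completeness can fail only when no edge is left.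

  The error probability for dropped edges comes from Markov's inequality and is a constant over
  \<open>2 ^ r\<close>, where \<open>r\<close> is the integer part of \<open>log d / k\<close>. It
  must vanish for large \<open>n\<close>, and this is the purpose of
  \<open>18 log n \<le> \<alpha>\<close>: together with
  \<open>\<alpha> log |\<Sigma>\<^sub>A| \<le> d powr (1 / k)\<close> it forces \<open>2 ^ r\<close>
  to be at least \<open>9 log n\<close>. The other two error terms are exponentially small in
  \<open>n\<close>.

  Only fair coins are available, so the rate is a power of two. Rounding costs a factor depending on
  \<open>k\<close>, which enters the error probability but not the constant
  \<open>c = 64\<close>.\<close>

lemma run_add: "run (s + t) cfg = bind_pmf (run s cfg) (run t)"
  by (induction s arbitrary: cfg) (auto simp: bind_return_pmf bind_assoc_pmf intro!: bind_pmf_cong)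

lemma run_halted [simp]: "run t ([], \<sigma>) = return_pmf ([], \<sigma>)"
  by (induction t) (simp_all add: bind_return_pmf)

text \<open>Quantifying over the rest \<open>ks\<close> of the program lets executions compose by
  equality of point distributions; the exact step count can be split with
  \<open>run_add\<close>.\<close>

definition exec :: "instr list \<Rightarrow> store \<Rightarrow> nat \<Rightarrow> store \<Rightarrow> bool" where
  "exec is \<sigma> t \<sigma>' \<longleftrightarrow> (\<forall>ks. run t (is @ ks, \<sigma>) = return_pmf (ks, \<sigma>'))"

lemma exec_Nil: "exec [] \<sigma> 0 \<sigma>"
  by (simp add: exec_def)

lemma exec_append:
  assumes "exec is \<sigma> s \<sigma>'" "exec js \<sigma>' t \<sigma>''"
  shows "exec (is @ js) \<sigma> (s + t) \<sigma>''"
  using assms by (simp add: exec_def run_add bind_return_pmf)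

lemma exec_Assign: "exec [Assign x e] \<sigma> 1 (\<sigma>(x := eval_expr e \<sigma>))"
  by (simp add: exec_def bind_return_pmf)

lemma exec_Assign_Cons:
  assumes "exec is (\<sigma>(x := eval_expr e \<sigma>)) t \<sigma>'"
  shows "exec (Assign x e # is) \<sigma> (Suc t) \<sigma>'"
  using exec_append[OF exec_Assign assms] by simp

lemma exec_Cond:
  assumes "exec (if eval_expr e \<sigma> \<noteq> Atom then js else ks) \<sigma> t \<sigma>'"
  shows "exec [Cond e js ks] \<sigma> (Suc t) \<sigma>'"
  using assms by (simp add: exec_def bind_return_pmf)

lemma exec_While_False:
  assumes "eval_expr e \<sigma> = Atom"
  shows "exec [While e js] \<sigma> (Suc 0) \<sigma>"
  using assms by (simp add: exec_def bind_return_pmf)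

lemma exec_While_True:
  assumes "eval_expr e \<sigma> \<noteq> Atom" "exec js \<sigma> s \<sigma>'" "exec [While e js] \<sigma>' t \<sigma>''"
  shows "exec [While e js] \<sigma> (Suc (s + t)) \<sigma>''"
proof -
  have "exec (js @ [While e js]) \<sigma> (s + t) \<sigma>''"
    using assms(2,3) by (rule exec_append)
  then show ?thesis
    using assms(1) by (simp add: exec_def bind_return_pmf)
qed

lemma poly_nat_mono: "m \<le> n \<Longrightarrow> poly (p :: nat poly) m \<le> poly p n"
  by (induction p) (auto intro!: add_mono mult_mono)

text \<open>
  Trees can share subtrees, so a program may produce a tree of exponential size in polynomial
  time; the bound on the output size is therefore a separate condition. Programs work on
  variable 0 and may leave garbage in the variables below \<open>m\<close>.
\<close>

definition ptime_by :: "instr list \<Rightarrow> nat \<Rightarrow> nat poly \<Rightarrow> (data \<Rightarrow> data) \<Rightarrow> bool" where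
  "ptime_by P m p f \<longleftrightarrow> 0 < m \<and>
     (\<forall>x. size (f x) \<le> poly p (size x)) \<and>
     (\<forall>\<sigma>. \<exists>t \<sigma>'. t \<le> poly p (size (\<sigma> 0)) \<and> exec P \<sigma> t \<sigma>' \<and> \<sigma>' 0 = f (\<sigma> 0) \<and>
        (\<forall>i\<ge>m. \<sigma>' i = \<sigma> i))"

definition ptime :: "(data \<Rightarrow> data) \<Rightarrow> bool" where
  "ptime f \<longleftrightarrow> (\<exists>P m p. ptime_by P m p f)"

lemma ptime_byD:
  assumes "ptime_by P m p f"
  shows "0 < m" "size (f x) \<le> poly p (size x)"
    "\<exists>t \<sigma>'. t \<le> poly p (size (\<sigma> 0)) \<and> exec P \<sigma> t \<sigma>' \<and> \<sigma>' 0 = f (\<sigma> 0) \<and> (\<forall>i\<ge>m. \<sigma>' i = \<sigma> i)"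
  using assms by (auto simp: ptime_by_def)

lemma ptimeI:
  assumes "0 < m" "\<And>x. size (f x) \<le> poly p (size x)"
    "\<And>\<sigma>. \<exists>t \<sigma>'. t \<le> poly p (size (\<sigma> 0)) \<and> exec P \<sigma> t \<sigma>' \<and> \<sigma>' 0 = f (\<sigma> 0) \<and> (\<forall>i\<ge>m. \<sigma>' i = \<sigma> i)"
  shows "ptime f"
  using assms unfolding ptime_def ptime_by_def by blast

lemma ptime_expr:
  assumes "\<And>\<sigma>. eval_expr e \<sigma> = f (\<sigma> 0)" "\<And>x. size (f x) \<le> poly p (size x)"
  shows "ptime f"
  unfolding ptime_def ptime_by_def
proof (intro exI conjI allI)
  show "0 < (1::nat)" by simp
  \<comment> \<open>The extra 1 pays for the single assignment even where \<open>p\<close>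
    vanishes.\<close>
  fix x show "size (f x) \<le> poly (p + 1) (size x)" using assms(2)[of x] by simp
next
  fix \<sigma> :: store
  show "1 \<le> poly (p + 1) (size (\<sigma> 0))" by simp
  show "exec [Assign 0 e] \<sigma> 1 (\<sigma>(0 := f (\<sigma> 0)))" using exec_Assign[of 0 e \<sigma>] assms(1) by simp
qed auto

lemma ptime_id: "ptime (\<lambda>x. x)"
  by (rule ptime_expr[of "Var 0" _ "[:0, 1:]"]) auto

lemma ptime_const: "ptime (\<lambda>x. v)"
  by (rule ptime_expr[of "Lit v" _ "[:size v:]"]) auto

lemma size_data_fst: "size (data_fst x) \<le> size x"
  by (cases x) auto

lemma size_data_snd: "size (data_snd x) \<le> size x"
  by (cases x) auto

lemma ptime_comp:
  assumes "ptime g" "ptime f"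
  shows "ptime (\<lambda>x. g (f x))"
proof -
  obtain P m p where f: "ptime_by P m p f" using assms by (auto simp: ptime_def)
  obtain Q l q where g: "ptime_by Q l q g" using assms by (auto simp: ptime_def)
  have q_le: "poly q (size (f x)) \<le> poly q (poly p (size x))" for x
    by (rule poly_nat_mono) (rule ptime_byD[OF f])
  show ?thesis
  proof (rule ptimeI[where P="P @ Q" and m="max m l" and p="p + pcompose q p"])
    show "0 < max m l" using ptime_byD[OF f] by simp
    show "size (g (f x)) \<le> poly (p + pcompose q p) (size x)" for x
      using ptime_byD(2)[OF g, of "f x"] q_le[of x] by (simp add: poly_pcompose)
    fix \<sigma> :: store
    obtain t \<sigma>' where 1: "t \<le> poly p (size (\<sigma> 0))" "exec P \<sigma> t \<sigma>'" "\<sigma>' 0 = f (\<sigma> 0)" "\<forall>i\<ge>m. \<sigma>' i = \<sigma> i"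
      using ptime_byD(3)[OF f] by blast
    obtain s \<sigma>'' where 2: "s \<le> poly q (size (\<sigma>' 0))" "exec Q \<sigma>' s \<sigma>''" "\<sigma>'' 0 = g (\<sigma>' 0)" "\<forall>i\<ge>l. \<sigma>'' i = \<sigma>' i"
      using ptime_byD(3)[OF g] by blast
    have "t + s \<le> poly (p + pcompose q p) (size (\<sigma> 0))"
      using 1 2 q_le[of "\<sigma> 0"] by (simp add: poly_pcompose)
    moreover have "exec (P @ Q) \<sigma> (t + s) \<sigma>''" using 1 2 exec_append by blast
    ultimately show "\<exists>t \<sigma>'. t \<le> poly (p + pcompose q p) (size (\<sigma> 0)) \<and> exec (P @ Q) \<sigma> t \<sigma>' \<and>
        \<sigma>' 0 = g (f (\<sigma> 0)) \<and> (\<forall>i\<ge>max m l. \<sigma>' i = \<sigma> i)"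
      using 1 2 by (intro exI[of _ "t + s"] exI[of _ \<sigma>'']) auto
  qed
qed

lemma ptime_fst: "ptime f \<Longrightarrow> ptime (\<lambda>x. data_fst (f x))"
  by (rule ptime_comp[of data_fst], rule ptime_expr[of "Hd (Var 0)" _ "[:0, 1:]"])
    (auto simp: size_data_fst)

lemma ptime_snd: "ptime f \<Longrightarrow> ptime (\<lambda>x. data_snd (f x))"
  by (rule ptime_comp[of data_snd], rule ptime_expr[of "Tl (Var 0)" _ "[:0, 1:]"])
    (auto simp: size_data_snd)

text \<open>Both programs overwrite variable 0, so the input and the first result wait in
  \<open>M\<close> and \<open>Suc M\<close>, beyond the variables that either program may
  change.\<close>

lemma ptime_Node:
  assumes "ptime f" "ptime g"
  shows "ptime (\<lambda>x. Node (f x) (g x))"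
proof -
  obtain P m p where f: "ptime_by P m p f" using assms by (auto simp: ptime_def)
  obtain Q l q where g: "ptime_by Q l q g" using assms by (auto simp: ptime_def)
  define M where "M = max m l"
  have M: "0 < M" "m \<le> M" "l \<le> M" using ptime_byD(1)[OF f] by (auto simp: M_def)
  let ?P = "Assign M (Var 0) # P @ [Assign (Suc M) (Var 0), Assign 0 (Var M)] @ Q @
    [Assign 0 (Join (Var (Suc M)) (Var 0))]"
  show ?thesis
  proof (rule ptimeI[where P="?P" and m="M + 2" and p="p + q + [:4:]"])
    show "0 < M + 2" by simp
    show "size (Node (f x) (g x)) \<le> poly (p + q + [:4:]) (size x)" for x
      using ptime_byD(2)[OF g, of x] ptime_byD(2)[OF f, of x] by simp
    fix \<sigma> :: store
    let ?\<sigma> = "\<sigma>(M := \<sigma> 0)"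
    obtain t \<sigma>' where 1: "t \<le> poly p (size (?\<sigma> 0))" "exec P ?\<sigma> t \<sigma>'" "\<sigma>' 0 = f (?\<sigma> 0)" "\<forall>i\<ge>m. \<sigma>' i = ?\<sigma> i"
      using ptime_byD(3)[OF f] by blast
    let ?\<sigma>' = "\<sigma>'(Suc M := \<sigma>' 0, 0 := \<sigma>' M)"
    obtain s \<sigma>'' where 2: "s \<le> poly q (size (?\<sigma>' 0))" "exec Q ?\<sigma>' s \<sigma>''" "\<sigma>'' 0 = g (?\<sigma>' 0)" "\<forall>i\<ge>l. \<sigma>'' i = ?\<sigma>' i"
      using ptime_byD(3)[OF g] by blast
    let ?\<sigma>'' = "\<sigma>''(0 := Node (\<sigma>'' (Suc M)) (\<sigma>'' 0))"
    have a: "exec [Assign (Suc M) (Var 0), Assign 0 (Var M)] \<sigma>' (Suc (Suc 0)) ?\<sigma>'"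
      using M by (intro exec_Assign_Cons) (simp add: exec_Nil)
    have b: "exec [Assign 0 (Join (Var (Suc M)) (Var 0))] \<sigma>'' (Suc 0) ?\<sigma>''"
      by (intro exec_Assign_Cons) (simp add: exec_Nil)
    have "exec ?P \<sigma> (Suc (t + (Suc (Suc 0) + (s + Suc 0)))) ?\<sigma>''"
      using exec_append[OF 1(2) exec_append[OF a exec_append[OF 2(2) b]]]
      by (intro exec_Assign_Cons) simp
    moreover have "\<sigma>' M = \<sigma> 0" using M 1 by simp
    ultimately show "\<exists>t \<sigma>'. t \<le> poly (p + q + [:4:]) (size (\<sigma> 0)) \<and> exec ?P \<sigma> t \<sigma>' \<and>
        \<sigma>' 0 = Node (f (\<sigma> 0)) (g (\<sigma> 0)) \<and> (\<forall>i\<ge>M + 2. \<sigma>' i = \<sigma> i)"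
      using 1 2 M by (intro exI[of _ "Suc (t + (Suc (Suc 0) + (s + Suc 0)))"] exI[of _ ?\<sigma>'']) auto
  qed
qed

text \<open>Evaluating the condition would destroy the input, so both are paired first and each
  branch begins by discarding the condition.\<close>

lemma ptime_If:
  assumes "ptime c" "ptime f" "ptime g"
  shows "ptime (\<lambda>x. if c x \<noteq> Atom then f x else g x)"
proof -
  define h where "h z = (if data_fst z \<noteq> Atom then f (data_snd z) else g (data_snd z))" for z
  have f': "ptime (\<lambda>z. f (data_snd z))" and g': "ptime (\<lambda>z. g (data_snd z))"
    using ptime_comp[OF assms(2) ptime_snd[OF ptime_id]] ptime_comp[OF assms(3) ptime_snd[OF ptime_id]] by simp_all
  obtain P m p where f: "ptime_by P m p (\<lambda>z. f (data_snd z))" using f' by (auto simp: ptime_def)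
  obtain Q l q where g: "ptime_by Q l q (\<lambda>z. g (data_snd z))" using g' by (auto simp: ptime_def)
  have "ptime h"
  proof (rule ptimeI[where P="[Cond (Hd (Var 0)) P Q]" and m="max m l" and p="p + q + 1"])
    show "0 < max m l" using ptime_byD[OF f] by simp
    show "size (h x) \<le> poly (p + q + 1) (size x)" for x
      using ptime_byD(2)[OF g, of x] ptime_byD(2)[OF f, of x] by (simp add: h_def)
    fix \<sigma> :: store
    show "\<exists>t \<sigma>'. t \<le> poly (p + q + 1) (size (\<sigma> 0)) \<and> exec [Cond (Hd (Var 0)) P Q] \<sigma> t \<sigma>' \<and>
        \<sigma>' 0 = h (\<sigma> 0) \<and> (\<forall>i\<ge>max m l. \<sigma>' i = \<sigma> i)"
    proof (cases "data_fst (\<sigma> 0) \<noteq> Atom")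
      case True
      obtain t \<sigma>' where 1: "t \<le> poly p (size (\<sigma> 0))" "exec P \<sigma> t \<sigma>'" "\<sigma>' 0 = f (data_snd (\<sigma> 0))" "\<forall>i\<ge>m. \<sigma>' i = \<sigma> i"
        using ptime_byD(3)[OF f] by blast
      moreover have "exec [Cond (Hd (Var 0)) P Q] \<sigma> (Suc t) \<sigma>'"
        by (rule exec_Cond) (use 1 True in simp)
      ultimately show ?thesis using True
        by (intro exI[of _ "Suc t"] exI[of _ \<sigma>']) (auto simp: h_def)
    next
      case False
      obtain t \<sigma>' where 1: "t \<le> poly q (size (\<sigma> 0))" "exec Q \<sigma> t \<sigma>'" "\<sigma>' 0 = g (data_snd (\<sigma> 0))" "\<forall>i\<ge>l. \<sigma>' i = \<sigma> i"
        using ptime_byD(3)[OF g] by blast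
      moreover have "exec [Cond (Hd (Var 0)) P Q] \<sigma> (Suc t) \<sigma>'"
        by (rule exec_Cond) (use 1 False in simp)
      ultimately show ?thesis using False
        by (intro exI[of _ "Suc t"] exI[of _ \<sigma>']) (auto simp: h_def)
    qed
  qed
  from ptime_comp[OF this ptime_Node[OF assms(1) ptime_id]] show ?thesis
    by (simp add: h_def cong: if_cong)
qed

section \<open>Bounded iteration over lists\<close>

primrec dlist :: "data \<Rightarrow> data list" where
  "dlist Atom = []"
| "dlist (Node x y) = x # dlist y"

lemma length_dlist: "length (dlist x) \<le> size x"
  by (induction x) auto

text \<open>\<open>c\<close> plays the part of a closure environment: a loop body is a fixed
  program, so every further parameter has to reach it as data.\<close>

definition dfold :: "(data \<Rightarrow> data) \<Rightarrow> data \<Rightarrow> data \<Rightarrow> data \<Rightarrow> data" where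
  "dfold g c l a = foldl (\<lambda>a e. g (Node c (Node e a))) a (dlist l)"

lemma dfold_simps [simp]:
  "dfold g c Atom a = a"
  "dfold g c (Node e l) a = dfold g c l (g (Node c (Node e a)))"
  by (simp_all add: dfold_def)

lemma size_dfold_le:
  assumes "\<And>c e a. size (g (Node c (Node e a))) \<le> size a + poly b (size c + size e)"
    and "size c + size l \<le> n"
  shows "size (dfold g c l a) \<le> size a + size l * poly b n"
  using assms(2)
proof (induction l arbitrary: a)
  case (Node e l)
  have "size (dfold g c (Node e l) a) \<le> size (g (Node c (Node e a))) + size l * poly b n"
    using Node by simp
  also have "size (g (Node c (Node e a))) \<le> size a + poly b n"
    using assms(1)[of c e a] poly_nat_mono[of "size c + size e" n b] Node.prems by simp
  finally show ?case by (simp add: algebra_simps)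
qed simp

text \<open>The invariant is that the accumulator plus the growth still allowed stays below
  \<open>S\<close>. A round costs the loop test, two assignments and the body, whose input
  \<open>Node c (Node e a)\<close> has size at most \<open>n + S + 2\<close>; the leading 1 is the
  final test.\<close>

lemma exec_dfold_loop:
  assumes g: "ptime_by P m p g"
    and b: "\<And>c e a. size (g (Node c (Node e a))) \<le> size a + poly b (size c + size e)"
    and "size c + size l \<le> n"
    and "\<sigma> m = c" "\<sigma> (Suc m) = l" "size (\<sigma> 0) + size l * poly b n \<le> S"
  shows "\<exists>t \<sigma>'. t \<le> 1 + size l * (poly p (n + S + 2) + 3) \<and>
     exec [While (Var (Suc m)) (Assign 0 (Join (Var m) (Join (Hd (Var (Suc m))) (Var 0))) # P @
            [Assign (Suc m) (Tl (Var (Suc m)))])] \<sigma> t \<sigma>' \<and>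
     \<sigma>' 0 = dfold g c l (\<sigma> 0) \<and> (\<forall>i>Suc m. \<sigma>' i = \<sigma> i)"
    (is "\<exists>t \<sigma>'. _ \<and> exec [While ?e ?js] \<sigma> t \<sigma>' \<and> _")
  using assms(3-)
proof (induction l arbitrary: \<sigma>)
  case Atom
  then show ?case
    by (intro exI[of _ 1] exI[of _ \<sigma>]) (auto intro!: exec_While_False)
next
  case (Node e l)
  have m: "0 < m" using ptime_byD[OF g] by simp
  let ?z = "Node c (Node e (\<sigma> 0))"
  let ?\<sigma> = "\<sigma>(0 := ?z)"
  obtain t \<sigma>' where t: "t \<le> poly p (size (?\<sigma> 0))" and P: "exec P ?\<sigma> t \<sigma>'"
      and r: "\<sigma>' 0 = g (?\<sigma> 0)" and u: "\<forall>i\<ge>m. \<sigma>' i = ?\<sigma> i"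
    using ptime_byD(3)[OF g] by blast
  have u1: "\<sigma>' m = c" "\<sigma>' (Suc m) = Node e l" and u2: "\<forall>i>Suc m. \<sigma>' i = \<sigma> i"
    using u m Node.prems(2,3) by auto
  have r': "\<sigma>' 0 = g ?z" using r by simp
  let ?\<sigma>' = "\<sigma>'(Suc m := l)"
  have sz: "size (g ?z) \<le> size (\<sigma> 0) + poly b n"
    using b[of c e "\<sigma> 0"] poly_nat_mono[of "size c + size e" n b] Node.prems(1) by simp
  have "size (g ?z) + size l * poly b n \<le> S"
    using Node.prems(4) sz by (simp add: algebra_simps)
  then have S: "size (?\<sigma>' 0) + size l * poly b n \<le> S" using r' by simp
  have w: "?\<sigma>' m = c" using u1 by simp
  have n: "size c + size l \<le> n" using Node.prems(1) by simp
  obtain s \<sigma>'' where s: "s \<le> 1 + size l * (poly p (n + S + 2) + 3)"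
    and W: "exec [While ?e ?js] ?\<sigma>' s \<sigma>''"
    and r2: "\<sigma>'' 0 = dfold g c l (?\<sigma>' 0)" and v: "\<forall>i>Suc m. \<sigma>'' i = ?\<sigma>' i"
    using Node.IH(2)[of ?\<sigma>', OF n w fun_upd_same S] by blast
  have "exec [Assign (Suc m) (Tl (Var (Suc m)))] \<sigma>' (Suc 0) ?\<sigma>'"
    using u1 exec_Assign[of "Suc m" "Tl (Var (Suc m))" \<sigma>'] by simp
  from exec_append[OF P this]
  have js: "exec ?js \<sigma> (Suc (t + Suc 0)) ?\<sigma>'"
    using Node.prems(2,3) by (intro exec_Assign_Cons) simp
  have "exec [While ?e ?js] \<sigma> (Suc (Suc (t + Suc 0) + s)) \<sigma>''"
    by (rule exec_While_True[OF _ js W]) (simp add: Node.prems(3))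
  moreover have "size ?z \<le> n + S + 2"
    using Node.prems(1,4) by simp
  from poly_nat_mono[OF this, of p] have "t \<le> poly p (n + S + 2)"
    using t by simp
  then have "Suc (Suc (t + Suc 0) + s) \<le> 1 + size (Node e l) * (poly p (n + S + 2) + 3)"
    using s by (simp add: algebra_simps)
  moreover have "\<sigma>'' 0 = dfold g c (Node e l) (\<sigma> 0)" using r2 r' by simp
  moreover have "\<forall>i>Suc m. \<sigma>'' i = \<sigma> i" using v u2 by simp
  ultimately show ?case by blast
qed

text \<open>Iterating a polynomial-time body can be exponential, for instance by repeated doubling.
  The increment may therefore depend on \<open>c\<close> and \<open>e\<close>, but not on the
  accumulator \<open>a\<close>.\<close>

lemma ptime_dfold:
  assumes "ptime g" "ptime fc" "ptime fl" "ptime fa"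
    and b: "\<And>c e a. size (g (Node c (Node e a))) \<le> size a + poly b (size c + size e)"
  shows "ptime (\<lambda>x. dfold g (fc x) (fl x) (fa x))"
proof -
  obtain P m p where g: "ptime_by P m p g" using assms by (auto simp: ptime_def)
  define h where "h z = dfold g (data_fst z) (data_fst (data_snd z)) (data_snd (data_snd z))" for z
  \<comment> \<open>\<open>B\<close> bounds the accumulator throughout; the 4 in \<open>T\<close>
    stands for the three initial assignments and the final loop test.\<close>
  define B where "B = [:0, 1:] + [:0, 1:] * b"
  define T where "T = [:4:] + [:0, 1:] * (pcompose p ([:0, 1:] + B + [:2:]) + [:3:])"
  have m: "0 < m" using ptime_byD[OF g] by simp
  let ?P = "[Assign m (Hd (Var 0)), Assign (Suc m) (Hd (Tl (Var 0))), Assign 0 (Tl (Tl (Var 0)))] @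
    [While (Var (Suc m)) (Assign 0 (Join (Var m) (Join (Hd (Var (Suc m))) (Var 0))) # P @
            [Assign (Suc m) (Tl (Var (Suc m)))])]"
  have *: "size (data_fst z) + size (data_fst (data_snd z)) \<le> size z"
     "size (data_snd (data_snd z)) + size (data_fst (data_snd z)) * poly b (size z) \<le> poly B (size z)" for z
  proof -
    have le: "size (data_fst z) + size (data_fst (data_snd z)) + size (data_snd (data_snd z)) \<le> size z"
      by (cases z; cases "data_snd z") auto
    then show "size (data_fst z) + size (data_fst (data_snd z)) \<le> size z" by simp
    show "size (data_snd (data_snd z)) + size (data_fst (data_snd z)) * poly b (size z) \<le> poly B (size z)"
      unfolding B_def using le by (auto intro!: add_mono mult_mono)
  qed
  have "ptime h"
  proof (rule ptimeI[where P="?P" and m="m + 2" and p="T + B"])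
    show "0 < m + 2" by simp
    fix z
    show "size (h z) \<le> poly (T + B) (size z)"
      using size_dfold_le[of g b "data_fst z" "data_fst (data_snd z)" "size z" "data_snd (data_snd z)", OF b *(1)] *(2)[of z]
      unfolding h_def poly_add by (meson order.trans trans_le_add2)
  next
    fix \<sigma> :: store
    let ?z = "\<sigma> 0"
    let ?\<sigma> = "\<sigma>(m := data_fst ?z, Suc m := data_fst (data_snd ?z), 0 := data_snd (data_snd ?z))"
    obtain t \<sigma>' where 1: "t \<le> 1 + size (data_fst (data_snd ?z)) * (poly p (size ?z + poly B (size ?z) + 2) + 3)"
     "exec [While (Var (Suc m)) (Assign 0 (Join (Var m) (Join (Hd (Var (Suc m))) (Var 0))) # P @
            [Assign (Suc m) (Tl (Var (Suc m)))])] ?\<sigma> t \<sigma>'"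
     "\<sigma>' 0 = dfold g (data_fst ?z) (data_fst (data_snd ?z)) (?\<sigma> 0)" "\<forall>i>Suc m. \<sigma>' i = ?\<sigma> i"
      using exec_dfold_loop[OF g b *(1), of ?\<sigma> ?z "poly B (size ?z)"] *(2)[of ?z] m by auto
    have a: "exec [Assign m (Hd (Var 0)), Assign (Suc m) (Hd (Tl (Var 0))), Assign 0 (Tl (Tl (Var 0)))]
       \<sigma> (Suc (Suc (Suc 0))) ?\<sigma>"
      using m by (intro exec_Assign_Cons) (simp add: exec_Nil)
    have "size (data_fst (data_snd ?z)) * (poly p (size ?z + poly B (size ?z) + 2) + 3) \<le>
      size ?z * (poly p (size ?z + poly B (size ?z) + 2) + 3)"
      using *(1)[of ?z] by (intro mult_mono) auto
    with 1(1) have "t \<le> 1 + size ?z * (poly p (size ?z + poly B (size ?z) + 2) + 3)"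
      by linarith
    then have "Suc (Suc (Suc 0)) + t \<le> poly (T + B) (size ?z)"
      by (simp add: T_def poly_pcompose)
    then show "\<exists>t \<sigma>'. t \<le> poly (T + B) (size (\<sigma> 0)) \<and> exec ?P \<sigma> t \<sigma>' \<and>
        \<sigma>' 0 = h (\<sigma> 0) \<and> (\<forall>i\<ge>m + 2. \<sigma>' i = \<sigma> i)"
      using exec_append[OF a 1(2)] 1 m
      by (intro exI[of _ "Suc (Suc (Suc 0)) + t"] exI[of _ \<sigma>']) (auto simp: h_def)
  qed
  from ptime_comp[OF this ptime_Node[OF assms(2) ptime_Node[OF assms(3,4)]]] show ?thesis
    by (simp add: h_def)
qed


section \<open>Coin flips followed by a deterministic computation\<close>

abbreviation flips :: "nat \<Rightarrow> bool list pmf" where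
  "flips n \<equiv> replicate_pmf n (bernoulli_pmf (1/2))"

definition enc_bool :: "bool \<Rightarrow> data" where
  "enc_bool b = (if b then Node Atom Atom else Atom)"

text \<open>The coin loop stacks its coins, so they come out reversed; as they are independent and
  identically distributed, the order is immaterial.\<close>

lemma map_rev_replicate_pmf: "map_pmf rev (replicate_pmf n p) = replicate_pmf n p"
proof (induction n)
  case (Suc n)
  have "map_pmf rev (replicate_pmf (Suc n) p) =
      p \<bind> (\<lambda>x. map_pmf rev (replicate_pmf n p) \<bind> (\<lambda>xs. return_pmf (xs @ [x])))"
    by (simp add: map_pmf_def bind_assoc_pmf bind_return_pmf)
  also have "\<dots> = replicate_pmf n p \<bind> (\<lambda>xs. p \<bind> (\<lambda>x. return_pmf (xs @ [x])))"
    unfolding Suc.IH by (rule bind_commute_pmf)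
  also have "\<dots> = replicate_pmf (n + 1) p"
    by (simp only: replicate_pmf_distrib) (simp add: bind_assoc_pmf bind_return_pmf)
  finally show ?case by simp
qed simp

text \<open>Variable 0 serves only as a counter. Resetting the coin variable makes the final store a
  function of the list stacked in variable \<open>m + 2\<close>.\<close>

definition coin_loop :: "nat \<Rightarrow> instr" where
  "coin_loop m = While (Var 0) [Flip (Suc m), Assign (m + 2) (Join (Var (Suc m)) (Var (m + 2))),
     Assign (Suc m) (Lit Atom), Assign 0 (Tl (Var 0))]"

lemma run_coin_loop:
  assumes "\<sigma> (Suc m) = Atom" "\<sigma> 0 = c"
  shows "run (5 * length (dlist c) + 1) (coin_loop m # ks, \<sigma>) =
    map_pmf (\<lambda>bs. (ks, \<sigma>(0 := Atom, m + 2 := fold (\<lambda>b. Node (enc_bool b)) bs (\<sigma> (m + 2)))))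
      (flips (length (dlist c)))"
  using assms
proof (induction c arbitrary: \<sigma>)
  case Atom
  then have "\<sigma>(0 := Atom) = \<sigma>" by auto
  then have "\<sigma>(0 := Atom, m + 2 := fold (\<lambda>b. Node (enc_bool b)) [] (\<sigma> (m + 2))) = \<sigma>" by simp
  then show ?case using Atom by (auto simp: coin_loop_def bind_return_pmf fun_eq_iff)
next
  case (Node e c)
  let ?n = "length (dlist c)"
  let ?\<sigma> = "\<lambda>b. \<sigma>(0 := c, m + 2 := Node (enc_bool b) (\<sigma> (m + 2)))"
  have upd: "\<sigma>(Suc m := b, m + 2 := v, Suc m := Atom, 0 := c) = \<sigma>(0 := c, m + 2 := v)" for b v
    using Node.prems by (auto simp: fun_eq_iff)
  have "5 * length (dlist (Node e c)) + 1 = Suc (Suc (Suc (Suc (Suc (5 * ?n + 1)))))" by simp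
  then have "run (5 * length (dlist (Node e c)) + 1) (coin_loop m # ks, \<sigma>) =
     bernoulli_pmf (1/2) \<bind> (\<lambda>b. run (5 * ?n + 1) (coin_loop m # ks, ?\<sigma> b))"
    using Node.prems upd
    by (simp only: run.simps)
      (simp add: coin_loop_def bind_return_pmf map_pmf_def bind_assoc_pmf enc_bool_def)
  also have "\<dots> = bernoulli_pmf (1/2) \<bind> (\<lambda>b. map_pmf (\<lambda>bs. (ks, (?\<sigma> b)(0 := Atom, m + 2 :=
       fold (\<lambda>b. Node (enc_bool b)) bs (?\<sigma> b (m + 2))))) (flips ?n))"
    using Node.prems by (intro bind_pmf_cong refl Node.IH(2)) auto
  also have "\<dots> = map_pmf (\<lambda>bs. (ks, \<sigma>(0 := Atom, m + 2 := fold (\<lambda>b. Node (enc_bool b)) bs (\<sigma> (m + 2)))))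
      (flips (length (dlist (Node e c))))"
    by (simp add: map_pmf_def bind_assoc_pmf bind_return_pmf fun_upd_twist)
  finally show ?case .
qed

lemma fold_Node_enc_bool: "fold (\<lambda>b. Node (enc_bool b)) bs Atom = enc_list enc_bool (rev bs)"
  by (simp add: enc_list_def foldr_conv_fold)

lemma size_enc_list_bool: "size (enc_list enc_bool bs) \<le> 2 * length bs"
  by (induction bs) (auto simp: enc_list_def enc_bool_def)

text \<open>Time bound and acceptance probability of a program refer to initial stores, so garbage
  must be erased before it is started on a computed input.\<close>

definition clear_vars :: "nat \<Rightarrow> instr list" where
  "clear_vars m = map (\<lambda>i. Assign i (Lit Atom)) [1..<m]"

lemma exec_clear_vars:
  "exec (clear_vars m) \<sigma> (m - 1) (\<lambda>i. if 0 < i \<and> i < m then Atom else \<sigma> i)"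
proof (induction m)
  case 0
  then show ?case by (simp add: clear_vars_def exec_Nil)
next
  case (Suc m)
  show ?case
  proof (cases "m = 0")
    case True
    then have "(\<lambda>i. if 0 < i \<and> i < Suc m then Atom else \<sigma> i) = \<sigma>" by auto
    with True show ?thesis by (simp add: clear_vars_def exec_Nil)
  next
    case False
    let ?\<sigma> = "\<lambda>i. if 0 < i \<and> i < m then Atom else \<sigma> i"
    have "exec (clear_vars m @ [Assign m (Lit Atom)]) \<sigma> (m - 1 + 1) (?\<sigma>(m := eval_expr (Lit Atom) ?\<sigma>))"
      by (rule exec_append[OF Suc.IH exec_Assign])
    moreover have "?\<sigma>(m := eval_expr (Lit Atom) ?\<sigma>) = (\<lambda>i. if 0 < i \<and> i < Suc m then Atom else \<sigma> i)"
      using False by (auto simp: fun_eq_iff)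
    moreover have "clear_vars (Suc m) = clear_vars m @ [Assign m (Lit Atom)]"
      using False by (simp add: clear_vars_def)
    ultimately show ?thesis using False by simp
  qed
qed

text \<open>Lets the clock of a composed program run on after the called program has halted.\<close>

lemma run_after_halt:
  assumes "\<forall>cfg \<in> set_pmf (run s cfg0). fst cfg = []" "s \<le> t"
  shows "run t cfg0 = run s cfg0"
proof -
  have "run (s + (t - s)) cfg0 = run s cfg0 \<bind> return_pmf"
    unfolding run_add
  proof (intro bind_pmf_cong refl)
    fix cfg assume "cfg \<in> set_pmf (run s cfg0)"
    then have "cfg = ([], snd cfg)" using assms(1) by (metis prod.collapse)
    then show "run (t - s) cfg = return_pmf cfg" by (metis run_halted)
  qed
  with assms(2) show ?thesis by (simp add: bind_return_pmf')
qed

lemma prob_bind_pmf: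
  "measure_pmf.prob (bind_pmf M N) X = measure_pmf.expectation M (\<lambda>x. measure_pmf.prob (N x) X)"
proof -
  have "ennreal (measure_pmf.prob (bind_pmf M N) X) = (\<integral>\<^sup>+x. ennreal (measure_pmf.prob (N x) X) \<partial>M)"
    by (simp flip: measure_pmf.emeasure_eq_measure)
  also have "\<dots> = ennreal (measure_pmf.expectation M (\<lambda>x. measure_pmf.prob (N x) X))"
    by (intro nn_integral_eq_integral measure_pmf.integrable_const_bound[where B = 1]) auto
  finally show ?thesis by (simp add: integral_nonneg_AE)
qed

text \<open>The output of \<open>cnt\<close> is read as a unary number, its length as a list. It is
  computed before any coin is flipped, so all coin sequences on one input have the same length and
  form a \<open>replicate_pmf\<close>.\<close>

lemma randomized_reduction:
  assumes "ptime cnt" "ptime R" "runs_in_time Q (poly q)"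
  obtains P p where "runs_in_time P (poly p)"
    "\<And>x. accept_prob P (poly p) x = measure_pmf.expectation (flips (length (dlist (cnt x))))
        (\<lambda>bs. accept_prob Q (poly q) (R (Node x (enc_list enc_bool bs))))"
proof -
  obtain Pc mc pc where c: "ptime_by Pc mc pc cnt" using assms(1) by (auto simp: ptime_def)
  obtain PR mR pR where R: "ptime_by PR mR pR R" using assms(2) by (auto simp: ptime_def)
  define M where "M = max mc mR"
  have M: "0 < M" "mc \<le> M" "mR \<le> M" using ptime_byD(1)[OF c] by (auto simp: M_def)
  define A1 where "A1 = Assign M (Var 0) # Pc"
  define A2 where "A2 = Assign 0 (Join (Var M) (Var (M + 2))) # PR @ clear_vars (M + 3)"
  define P where "P = A1 @ coin_loop M # A2 @ Q"
  \<comment> \<open>\<open>Z\<close> bounds the input paired with the coins, each coin taking at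
    most two nodes. In \<open>p\<close>, the part \<open>2 + 6 * pc\<close> covers the run up to the
    end of the coin loop, \<open>M + 3\<close> the pairing and clearing, and the compositions cover
    \<open>R\<close> and then \<open>Q\<close>.\<close>
  define Z where "Z = [:1, 1:] + [:2:] * pc"
  define p where "p = [:M + 5:] + [:6:] * pc + pcompose pR Z + pcompose q (pcompose pR Z)"
  define n where "n x = length (dlist (cnt x))" for x
  define y where "y x bs = R (Node x (enc_list enc_bool bs))" for x bs

  have main: "run (poly p (size x)) (initial P x) =
      flips (n x) \<bind> (\<lambda>bs. run (poly q (size (y x bs))) (initial Q (y x bs)))" for x
  proof -
    let ?s = "size x"
    let ?\<sigma>0 = "((\<lambda>_. Atom)(0 := x)) :: store"
    let ?\<sigma>1 = "?\<sigma>0(M := x)"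
    obtain t1 \<sigma> where t1: "t1 \<le> poly pc (size (?\<sigma>1 0))" and c': "exec Pc ?\<sigma>1 t1 \<sigma>"
      and \<sigma>: "\<sigma> 0 = cnt (?\<sigma>1 0)" "\<forall>i\<ge>mc. \<sigma> i = ?\<sigma>1 i"
      using ptime_byD(3)[OF c] by blast
    have A1: "exec A1 ?\<sigma>0 (Suc t1) \<sigma>"
      unfolding A1_def by (rule exec_Assign_Cons) (use c' in simp)
    have \<sigma>v: "\<sigma> M = x" "\<sigma> (Suc M) = Atom" "\<sigma> (M + 2) = Atom" "\<sigma> 0 = cnt x" "\<forall>i>M. \<sigma> i = Atom"
      using \<sigma> M by auto
    have n: "n x \<le> poly pc ?s"
      using length_dlist[of "cnt x"] ptime_byD(2)[OF c, of x] by (simp add: n_def)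
    define \<sigma>2 where "\<sigma>2 bs = \<sigma>(0 := Atom, M + 2 := enc_list enc_bool bs)" for bs
    have "run (5 * n x + 1) (coin_loop M # A2 @ Q, \<sigma>) =
        map_pmf (\<lambda>bs. (A2 @ Q, \<sigma>2 (rev bs))) (flips (n x))"
      unfolding n_def using \<sigma>v by (subst run_coin_loop) (simp_all add: fold_Node_enc_bool \<sigma>2_def)
    also have "\<dots> = map_pmf (\<lambda>bs. (A2 @ Q, \<sigma>2 bs)) (map_pmf rev (flips (n x)))"
      by (simp add: pmf.map_comp o_def)
    finally have loop: "run (5 * n x + 1) (coin_loop M # A2 @ Q, \<sigma>) =
        map_pmf (\<lambda>bs. (A2 @ Q, \<sigma>2 bs)) (flips (n x))"
      by (simp add: map_rev_replicate_pmf)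
    define t where "t = Suc t1 + (5 * n x + 1)"
    have "run t (initial P x) = map_pmf (\<lambda>bs. (A2 @ Q, \<sigma>2 bs)) (flips (n x))"
      unfolding t_def run_add[of "Suc t1"] using A1 loop
      by (simp only: initial_def P_def exec_def bind_return_pmf)
    moreover have t: "t \<le> poly ([:2:] + [:6:] * pc) ?s" using t1 n M by (simp add: t_def)
    then have "t \<le> poly p ?s" by (simp add: p_def)
    ultimately have "run (poly p ?s) (initial P x) =
        flips (n x) \<bind> (\<lambda>bs. run (poly p ?s - t) (A2 @ Q, \<sigma>2 bs))"
      using run_add[of t "poly p ?s - t" "initial P x"] by (simp add: bind_map_pmf)
    also have "\<dots> = flips (n x) \<bind> (\<lambda>bs. run (poly q (size (y x bs))) (initial Q (y x bs)))"
    proof (intro bind_pmf_cong refl)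
      fix bs assume "bs \<in> set_pmf (flips (n x))"
      then have len: "length bs = n x" by (simp add: set_replicate_pmf)
      let ?z = "Node x (enc_list enc_bool bs)"
      let ?\<sigma>3 = "(\<sigma>2 bs)(0 := ?z)"
      obtain t2 \<sigma>4 where t2: "t2 \<le> poly pR (size (?\<sigma>3 0))" and R': "exec PR ?\<sigma>3 t2 \<sigma>4"
        and \<sigma>4: "\<sigma>4 0 = R (?\<sigma>3 0)" "\<forall>i\<ge>mR. \<sigma>4 i = ?\<sigma>3 i"
        using ptime_byD(3)[OF R] by blast
      have z: "size ?z \<le> poly Z ?s"
        using size_enc_list_bool[of bs] n len by (simp add: Z_def)
      have t2': "t2 \<le> poly pR (poly Z ?s)"
        using t2 poly_nat_mono[OF z, of pR] by simp
      have sy: "size (y x bs) \<le> poly pR (poly Z ?s)"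
        unfolding y_def using ptime_byD(2)[OF R, of ?z] poly_nat_mono[OF z, of pR] by simp
      have st: "(\<lambda>i. if 0 < i \<and> i < M + 3 then Atom else \<sigma>4 i) = (\<lambda>_. Atom)(0 := y x bs)"
      proof
        fix i
        show "(if 0 < i \<and> i < M + 3 then Atom else \<sigma>4 i) = ((\<lambda>_. Atom)(0 := y x bs)) i"
          using \<sigma>4 \<sigma>v M by (auto simp: y_def \<sigma>2_def)
      qed
      have "exec (PR @ clear_vars (M + 3)) ?\<sigma>3 (t2 + (M + 3 - 1)) ((\<lambda>_. Atom)(0 := y x bs))"
        using exec_append[OF R' exec_clear_vars[of "M + 3"]] unfolding st .
      then have A2: "exec A2 (\<sigma>2 bs) (Suc (t2 + (M + 2))) ((\<lambda>_. Atom)(0 := y x bs))"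
        unfolding A2_def using \<sigma>v M by (intro exec_Assign_Cons) (simp add: \<sigma>2_def)
      define u where "u = poly p ?s - t - Suc (t2 + (M + 2))"
      have "t + Suc (t2 + (M + 2)) + poly q (size (y x bs)) \<le> poly p ?s"
        using t t2' poly_nat_mono[OF sy, of q] by (simp add: p_def poly_pcompose)
      then have u: "poly p ?s - t = Suc (t2 + (M + 2)) + u" "poly q (size (y x bs)) \<le> u"
        by (simp_all add: u_def)
      have "run (poly p ?s - t) (A2 @ Q, \<sigma>2 bs) = run u (initial Q (y x bs))"
        unfolding u(1) run_add using A2 by (simp add: exec_def bind_return_pmf initial_def)
      also have "\<dots> = run (poly q (size (y x bs))) (initial Q (y x bs))"
        by (rule run_after_halt[OF _ u(2)]) (use assms(3) in \<open>auto simp: runs_in_time_def\<close>)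
      finally show "run (poly p ?s - t) (A2 @ Q, \<sigma>2 bs) =
        run (poly q (size (y x bs))) (initial Q (y x bs))" .
    qed
    finally show ?thesis .
  qed
  show ?thesis
  proof (rule that)
    show "runs_in_time P (poly p)"
      using assms(3) by (auto simp: runs_in_time_def main)
    show "accept_prob P (poly p) x = measure_pmf.expectation (flips (length (dlist (cnt x))))
        (\<lambda>bs. accept_prob Q (poly q) (R (Node x (enc_list enc_bool bs))))" for x
      unfolding accept_prob_def main prob_bind_pmf by (simp add: n_def y_def)
  qed
qed

section \<open>The reduction on encoded instances\<close>

named_theorems ptime_intros

declare ptime_id [ptime_intros] ptime_const [ptime_intros] ptime_fst [ptime_intros]
  ptime_snd [ptime_intros] ptime_Node [ptime_intros] ptime_If [ptime_intros]

lemma dlist_enc_nat [simp]: "dlist (enc_nat n) = replicate n Atom"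
  by (induction n) auto

lemma enc_nat_eq_Atom_iff [simp]: "enc_nat n = Atom \<longleftrightarrow> n = 0"
  by (cases n) auto

lemma enc_list_simps [simp]:
  "enc_list f [] = Atom" "enc_list f (x # xs) = Node (f x) (enc_list f xs)"
  by (simp_all add: enc_list_def)

lemma dlist_enc_list [simp]: "dlist (enc_list f xs) = map f xs"
  by (induction xs) auto

text \<open>Only the length of \<open>u\<close> counts. On unary numbers this is truncated
  subtraction, which yields order and equality tests because \<open>Atom\<close> is both zero and
  false; dropping past the end is harmless since \<open>data_snd Atom = Atom\<close>.\<close>

definition ddrop :: "data \<Rightarrow> data \<Rightarrow> data" where
  "ddrop u v = dfold (\<lambda>z. data_snd (data_snd (data_snd z))) Atom u v"

lemma ddrop_simps [simp]: "ddrop Atom v = v" "ddrop (Node e u) v = ddrop u (data_snd v)"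
  by (simp_all add: ddrop_def)

lemma ptime_ddrop [ptime_intros]: "ptime f \<Longrightarrow> ptime g \<Longrightarrow> ptime (\<lambda>x. ddrop (f x) (g x))"
  unfolding ddrop_def
  by (rule ptime_dfold[where b = 0]) (auto intro!: ptime_intros simp: size_data_snd)

lemma size_ddrop: "size (ddrop u v) \<le> size v"
proof (induction u arbitrary: v)
  case (Node e u)
  from order.trans[OF Node.IH(2) size_data_snd] show ?case by simp
qed simp

lemma length_ddrop: "length (dlist (ddrop u v)) = length (dlist v) - length (dlist u)"
proof (induction u arbitrary: v)
  case (Node e u)
  then show ?case by (cases v) auto
qed simp

lemma dlist_eq_Nil_iff [simp]: "dlist v = [] \<longleftrightarrow> v = Atom"
  by (cases v) auto

lemma ddrop_eq_Atom_iff: "ddrop u v = Atom \<longleftrightarrow> length (dlist v) \<le> length (dlist u)"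
  using length_ddrop[of u v] by (metis diff_is_0_eq dlist_eq_Nil_iff length_0_conv)

lemma ddrop_enc_list: "ddrop (enc_nat j) (enc_list f xs) = enc_list f (drop j xs)"
proof (induction j arbitrary: xs)
  case (Suc j)
  then show ?case using Suc[of "[]"] by (cases xs) auto
qed simp

definition deq :: "data \<Rightarrow> data \<Rightarrow> data" where
  "deq u v = (if ddrop u v \<noteq> Atom then Atom else if ddrop v u \<noteq> Atom then Atom else Node Atom Atom)"

lemma ptime_deq [ptime_intros]: "ptime f \<Longrightarrow> ptime g \<Longrightarrow> ptime (\<lambda>x. deq (f x) (g x))"
  unfolding deq_def by (intro ptime_intros)

lemma deq_enc_nat [simp]: "deq (enc_nat m) (enc_nat n) = Atom \<longleftrightarrow> m \<noteq> n"
  by (auto simp: deq_def ddrop_eq_Atom_iff)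

text \<open>Bounded existential search; \<open>c\<close> again supplies the free variables of the
  predicate.\<close>

definition dex :: "(data \<Rightarrow> data) \<Rightarrow> data \<Rightarrow> data \<Rightarrow> data" where
  "dex g c l = dfold (\<lambda>z. if g (Node (data_fst z) (data_fst (data_snd z))) \<noteq> Atom then Node Atom Atom
     else data_snd (data_snd z)) c l Atom"

lemma ptime_dex:
  assumes "ptime g" "ptime f" "ptime f'"
  shows "ptime (\<lambda>x. dex g (f x) (f' x))"
  unfolding dex_def
  by (rule ptime_dfold[where b = 1]) (auto intro!: ptime_intros ptime_comp[OF assms(1)] assms)

lemma dex_eq_Atom_iff: "dex g c l = Atom \<longleftrightarrow> (\<forall>e \<in> set (dlist l). g (Node c e) = Atom)"
proof -
  have "dfold (\<lambda>z. if g (Node (data_fst z) (data_fst (data_snd z))) \<noteq> Atom then Node Atom Atom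
     else data_snd (data_snd z)) c l a = Atom \<longleftrightarrow> a = Atom \<and> (\<forall>e \<in> set (dlist l). g (Node c e) = Atom)" for a
    by (induction l arbitrary: a) auto
  then show ?thesis by (simp add: dex_def)
qed

section \<open>Short walks and greedy insertion\<close>

primrec walk :: "('a \<times> 'b) set \<Rightarrow> nat \<Rightarrow> 'a \<Rightarrow> 'b \<Rightarrow> bool" where
  "walk E 0 a b \<longleftrightarrow> (a, b) \<in> E"
| "walk E (Suc i) a b \<longleftrightarrow> (\<exists>b' a'. (a, b') \<in> E \<and> (a', b') \<in> E \<and> walk E i a' b)"

text \<open>The argument is \<open>Node a (Node b F)\<close>, where \<open>F\<close> is a list of edges with their relations.\<close>

primrec dwalk :: "nat \<Rightarrow> data \<Rightarrow> data" where
  "dwalk 0 = (\<lambda>z. dex (\<lambda>y.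
     if deq (data_fst (data_fst (data_snd y))) (data_fst (data_fst y)) \<noteq> Atom
     then deq (data_snd (data_fst (data_snd y))) (data_fst (data_snd (data_fst y))) else Atom)
     z (data_snd (data_snd z)))"
| "dwalk (Suc i) = (\<lambda>z. dex (\<lambda>y.
     if deq (data_fst (data_fst (data_snd y))) (data_fst (data_fst y)) \<noteq> Atom
     then dex (\<lambda>y'.
       if deq (data_snd (data_fst (data_snd y'))) (data_snd (data_fst (data_snd (data_fst y')))) \<noteq> Atom
       then dwalk i (Node (data_fst (data_fst (data_snd y'))) (data_snd (data_fst (data_fst y')))) else Atom)
       y (data_snd (data_snd (data_fst y))) else Atom)
     z (data_snd (data_snd z)))"

text \<open>\<open>i\<close> is fixed when the program is written, so the recursion unfolds into
  \<open>2 * i + 1\<close> nested loops. The degree of the time bound grows with \<open>i\<close>,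
  which is harmless for constant \<open>k\<close>.\<close>

lemma ptime_dwalk: "ptime (dwalk i)"
proof (induction i)
  case 0
  show ?case unfolding dwalk.simps by (intro ptime_intros ptime_dex)
next
  case (Suc i)
  show ?case unfolding dwalk.simps by (intro ptime_intros ptime_dex ptime_comp[OF Suc])
qed

definition enc_edge :: "(nat \<times> nat \<Rightarrow> (nat \<times> nat) list) \<Rightarrow> nat \<times> nat \<Rightarrow> data" where
  "enc_edge rs e = Node (enc_nat_pair e) (enc_list enc_nat_pair (rs e))"

lemma dwalk_iff:
  "dwalk i (Node (enc_nat a) (Node (enc_nat b) (enc_list (enc_edge rs) es))) \<noteq> Atom \<longleftrightarrow> walk (set es) i a b"
proof (induction i arbitrary: a)
  case 0
  have "dwalk 0 (Node (enc_nat a) (Node (enc_nat b) (enc_list (enc_edge rs) es))) \<noteq> Atom \<longleftrightarrow>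
    (\<exists>e\<in>set es. fst e = a \<and> snd e = b)"
    by (auto simp: dex_eq_Atom_iff enc_edge_def enc_nat_pair_def split_beta)
  then show ?case by force
next
  case (Suc i)
  have "dwalk (Suc i) (Node (enc_nat a) (Node (enc_nat b) (enc_list (enc_edge rs) es))) \<noteq> Atom \<longleftrightarrow>
    (\<exists>e\<in>set es. fst e = a \<and> (\<exists>e'\<in>set es. snd e' = snd e \<and>
       dwalk i (Node (enc_nat (fst e')) (Node (enc_nat b) (enc_list (enc_edge rs) es))) \<noteq> Atom))"
    unfolding dwalk.simps(2)
    by (simp add: dex_eq_Atom_iff enc_edge_def enc_nat_pair_def split_beta) blast
  then show ?case unfolding Suc.IH by force
qed

definition greedy :: "nat \<Rightarrow> ('a \<times> 'b) list \<Rightarrow> ('a \<times> 'b) list" where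
  "greedy h es = fold (\<lambda>(a, b) G. if walk (set G) h a b then G else (a, b) # G) es []"

definition dgreedy :: "nat \<Rightarrow> data \<Rightarrow> data" where
  "dgreedy h l = dfold (\<lambda>z. if dwalk h (Node (data_fst (data_fst (data_fst (data_snd z))))
       (Node (data_snd (data_fst (data_fst (data_snd z)))) (data_snd (data_snd z)))) \<noteq> Atom
     then data_snd (data_snd z) else Node (data_fst (data_snd z)) (data_snd (data_snd z))) Atom l Atom"

lemma ptime_dgreedy [ptime_intros]: "ptime f \<Longrightarrow> ptime (\<lambda>x. dgreedy h (f x))"
  unfolding dgreedy_def
  by (rule ptime_dfold[where b = "[:1, 1:]"]) (auto intro!: ptime_intros ptime_comp[OF ptime_dwalk])

lemma dgreedy_enc_list:
  "dgreedy h (enc_list (enc_edge rs) es) = enc_list (enc_edge rs) (greedy h es)"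
proof -
  have "dfold (\<lambda>z. if dwalk h (Node (data_fst (data_fst (data_fst (data_snd z))))
       (Node (data_snd (data_fst (data_fst (data_snd z)))) (data_snd (data_snd z)))) \<noteq> Atom
     then data_snd (data_snd z) else Node (data_fst (data_snd z)) (data_snd (data_snd z))) Atom
       (enc_list (enc_edge rs) es) (enc_list (enc_edge rs) G) =
     enc_list (enc_edge rs) (fold (\<lambda>(a, b) G. if walk (set G) h a b then G else (a, b) # G) es G)" for G
  proof (induction es arbitrary: G)
    case (Cons e es)
    obtain a b where e: "e = (a, b)" by force
    have f: "data_fst (data_fst (enc_edge rs e)) = enc_nat a" "data_snd (data_fst (enc_edge rs e)) = enc_nat b"
      by (simp_all add: enc_edge_def enc_nat_pair_def e)
    show ?case
    proof (cases "walk (set G) h a b")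
      case True
      with dwalk_iff[of h a b rs G] show ?thesis
        by (simp add: f) (simp add: Cons e)
    next
      case False
      with dwalk_iff[of h a b rs G] show ?thesis
        using Cons[of "e # G"] by (simp add: f) (simp add: e)
    qed
  qed simp
  from this[of "[]"] show ?thesis by (simp add: dgreedy_def greedy_def)
qed

section \<open>Unary arithmetic and the sampling rate\<close>

definition dadd :: "data \<Rightarrow> data \<Rightarrow> data" where
  "dadd u v = dfold (\<lambda>z. Node Atom (data_snd (data_snd z))) Atom u v"

lemma dadd_simps [simp]: "dadd Atom v = v" "dadd (Node e u) v = dadd u (Node Atom v)"
  by (simp_all add: dadd_def)

lemma ptime_dadd [ptime_intros]: "ptime f \<Longrightarrow> ptime g \<Longrightarrow> ptime (\<lambda>x. dadd (f x) (g x))"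
  unfolding dadd_def by (rule ptime_dfold[where b = 1]) (auto intro!: ptime_intros)

lemma size_dadd: "size (dadd u v) = length (dlist u) + size v"
  by (induction u arbitrary: v) auto

lemma length_dadd: "length (dlist (dadd u v)) = length (dlist u) + length (dlist v)"
  by (induction u arbitrary: v) auto

lemma dadd_enc_nat: "dadd (enc_nat m) (enc_nat n) = enc_nat (m + n)"
proof (induction m arbitrary: n)
  case (Suc m)
  from Suc[of "Suc n"] show ?case by simp
qed simp

definition dmul :: "data \<Rightarrow> data \<Rightarrow> data" where
  "dmul u l = dfold (\<lambda>z. dadd (data_fst z) (data_snd (data_snd z))) u l Atom"

lemma ptime_dmul [ptime_intros]: "ptime f \<Longrightarrow> ptime g \<Longrightarrow> ptime (\<lambda>x. dmul (f x) (g x))"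
  unfolding dmul_def
  by (rule ptime_dfold[where b = "[:0, 1:]"])
    (auto intro!: ptime_intros simp: size_dadd intro: order.trans[OF length_dlist])

lemma length_dmul: "length (dlist (dmul u l)) = length (dlist l) * length (dlist u)"
proof -
  have "length (dlist (dfold (\<lambda>z. dadd (data_fst z) (data_snd (data_snd z))) u l a)) =
    length (dlist l) * length (dlist u) + length (dlist a)" for a
    by (induction l arbitrary: a) (auto simp: length_dadd)
  then show ?thesis by (simp add: dmul_def)
qed

text \<open>
  This counts the edges at vertex \<open>0\<close> of \<open>A\<close>, whose encoding is \<^term>\<open>Atom\<close>; in a regular
  instance any vertex gives the degree.
\<close>

definition ddegree :: "data \<Rightarrow> data" where
  "ddegree l = dfold (\<lambda>z. if data_fst (data_fst (data_fst (data_snd z))) \<noteq> Atom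
     then data_snd (data_snd z) else Node Atom (data_snd (data_snd z))) Atom l Atom"

lemma ptime_ddegree [ptime_intros]: "ptime f \<Longrightarrow> ptime (\<lambda>x. ddegree (f x))"
  unfolding ddegree_def by (rule ptime_dfold[where b = 1]) (auto intro!: ptime_intros)

lemma ddegree_enc_list:
  "ddegree (enc_list (enc_edge rs) es) = enc_nat (length (filter (\<lambda>e. fst e = 0) es))"
proof -
  have "dfold (\<lambda>z. if data_fst (data_fst (data_fst (data_snd z))) \<noteq> Atom
     then data_snd (data_snd z) else Node Atom (data_snd (data_snd z))) Atom (enc_list (enc_edge rs) es) (enc_nat n)
     = enc_nat (length (filter (\<lambda>e. fst e = 0) es) + n)" for n
  proof (induction es arbitrary: n)
    case (Cons e es)
    have "data_fst (data_fst (enc_edge rs e)) = enc_nat (fst e)"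
      by (simp add: enc_edge_def enc_nat_pair_def split_beta)
    then show ?case using Cons[of n] Cons[of "Suc n"] by auto
  qed simp
  from this[of 0] show ?thesis by (simp add: ddegree_def)
qed

primrec dshift :: "nat \<Rightarrow> data \<Rightarrow> data" where
  "dshift 0 u = u"
| "dshift (Suc k) u = dadd (dshift k u) (dshift k u)"

lemma ptime_dshift [ptime_intros]: "ptime f \<Longrightarrow> ptime (\<lambda>x. dshift k (f x))"
  by (induction k) (auto intro: ptime_intros)

text \<open>Doubling lengthens the spine by atoms and leaves the old entries alone. This is tracked
  for arbitrary trees because the size bound in \<open>ptime_dfold\<close> has to hold for every
  accumulator, not just for numerals.\<close>

lemma size_dshift: "size (dshift k u) + length (dlist u) = size u + length (dlist (dshift k u))"
  by (induction k) (auto simp: size_dadd length_dadd)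

lemma dshift_enc_nat: "dshift k (enc_nat n) = enc_nat (2 ^ k * n)"
  by (induction k) (auto simp: dadd_enc_nat mult_2 algebra_simps)

text \<open>
  The accumulator is \<open>(2 ^ (k * r), (k - 1) * r)\<close>; the exponent \<open>r\<close> increases as long as
  \<open>2 ^ (k * r)\<close> does not exceed the degree.
\<close>

definition dexp_step :: "nat \<Rightarrow> data \<Rightarrow> data" where
  "dexp_step k z = (if ddrop (data_fst z) (dshift k (data_fst (data_snd (data_snd z)))) \<noteq> Atom
     then data_snd (data_snd z)
     else Node (dshift k (data_fst (data_snd (data_snd z))))
       (dadd (enc_nat (k - 1)) (data_snd (data_snd (data_snd z)))))"

definition dexp :: "nat \<Rightarrow> data \<Rightarrow> data" where
  "dexp k c = data_snd (dfold (dexp_step k) c c (Node (enc_nat 1) (enc_nat 0)))"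

text \<open>A new power is stored only if it is no longer than \<open>c\<close>; this cap turns
  multiplication by \<open>2 ^ k\<close> into additive growth.\<close>

lemma size_dexp_step: "size (dexp_step k (Node c (Node e a))) \<le> size a + (size c + size e + k + 1)"
proof (cases "ddrop c (dshift k (data_fst a)) = Atom")
  case True
  then have "length (dlist (dshift k (data_fst a))) \<le> length (dlist c)"
    by (simp add: ddrop_eq_Atom_iff)
  then have "size (dshift k (data_fst a)) \<le> size (data_fst a) + size c"
    using size_dshift[of k "data_fst a"] length_dlist[of c] by simp
  moreover have "size (data_fst a) + size (data_snd a) \<le> size a" by (cases a) auto
  ultimately show ?thesis by (simp add: dexp_step_def True size_dadd)
qed (simp add: dexp_step_def)

lemma ptime_dexp [ptime_intros]:
  assumes "ptime f"
  shows "ptime (\<lambda>x. dexp k (f x))"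
proof -
  have "ptime (dexp_step k)" unfolding dexp_step_def[abs_def] by (intro ptime_intros)
  moreover have "size (dexp_step k (Node c (Node e a))) \<le> size a + poly [:k + 1, 1:] (size c + size e)" for c e a
    using size_dexp_step[of k c e a] by simp
  ultimately have "ptime (\<lambda>x. dfold (dexp_step k) (f x) (f x) (Node (enc_nat 1) (enc_nat 0)))"
    using assms by (intro ptime_dfold[where b = "[:k + 1, 1:]"] ptime_const)
  then show ?thesis unfolding dexp_def by (rule ptime_snd)
qed

lemma dexp_step_enc_nat:
  "dexp_step k (Node (enc_nat d) (Node e (Node (enc_nat u) (enc_nat j)))) =
     (if 2 ^ k * u \<le> d then Node (enc_nat (2 ^ k * u)) (enc_nat (k - 1 + j)) else Node (enc_nat u) (enc_nat j))"
  by (simp add: dexp_step_def dshift_enc_nat dadd_enc_nat ddrop_eq_Atom_iff)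

text \<open>Repeated multiplication finds \<open>r\<close>, the integer part of
  \<open>log d / k\<close>, without roots or logarithms. Keeping edges with probability
  \<open>2 ^ -((k - 1) * r)\<close> then leaves a mean degree between \<open>2 ^ r\<close> and
  \<open>2 ^ k * 2 ^ r\<close>.\<close>

lemma dexp_enc_nat:
  assumes "0 < d" "0 < k"
  obtains r where "dexp k (enc_nat d) = enc_nat ((k - 1) * r)" "2 ^ (k * r) \<le> d" "d < 2 ^ (k * Suc r)"
proof -
  let ?s = "\<lambda>r. Node (enc_nat (2 ^ (k * r))) (enc_nat ((k - 1) * r))"
  \<comment> \<open>Once \<open>2 ^ (k * Suc r)\<close> exceeds \<open>d\<close> the accumulator is
    stationary; the other alternative is that every round raised the exponent.\<close>
  have "\<exists>r. dfold (dexp_step k) (enc_nat d) (enc_nat n) (?s r0) = ?s r \<and>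
      2 ^ (k * r) \<le> d \<and> (r = r0 + n \<or> d < 2 ^ (k * Suc r))" if "2 ^ (k * r0) \<le> d" for n r0
    using that
  proof (induction n arbitrary: r0)
    case (Suc n)
    have pow: "2 ^ k * 2 ^ (k * r0) = (2::nat) ^ (k * Suc r0)" by (simp add: power_add)
    show ?case
    proof (cases "2 ^ (k * Suc r0) \<le> d")
      case True
      have j: "k - 1 + (k - 1) * r0 = (k - 1) * Suc r0" by simp
      have "dfold (dexp_step k) (enc_nat d) (enc_nat (Suc n)) (?s r0) =
          dfold (dexp_step k) (enc_nat d) (enc_nat n) (?s (Suc r0))"
        using True by (simp only: enc_nat.simps(2) dfold_simps dexp_step_enc_nat pow j if_True)
      then show ?thesis using Suc.IH[OF True] by (metis add_Suc add_Suc_right)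
    next
      case False
      then have "dfold (dexp_step k) (enc_nat d) (enc_nat (Suc n)) (?s r0) =
          dfold (dexp_step k) (enc_nat d) (enc_nat n) (?s r0)"
        by (simp only: enc_nat.simps(2) dfold_simps dexp_step_enc_nat pow if_False)
      moreover obtain r where r: "dfold (dexp_step k) (enc_nat d) (enc_nat n) (?s r0) = ?s r"
          "2 ^ (k * r) \<le> d" "r = r0 + n \<or> d < 2 ^ (k * Suc r)"
        using Suc.IH[OF Suc.prems] by blast
      have "d < 2 ^ (k * Suc r)"
        using r(3)
      proof
        assume "r = r0 + n"
        then have "(2::nat) ^ (k * Suc r0) \<le> 2 ^ (k * Suc r)" by (intro power_increasing mult_le_mono) auto
        with False show ?thesis by linarith
      qed
      ultimately show ?thesis using r by metis
    qed
  qed auto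
  moreover have "2 ^ (k * 0) \<le> d" using assms by simp
  ultimately obtain r where r: "dfold (dexp_step k) (enc_nat d) (enc_nat d) (?s 0) = ?s r"
      "2 ^ (k * r) \<le> d" "r = 0 + d \<or> d < 2 ^ (k * Suc r)"
    by blast
  have "dexp k (enc_nat d) = enc_nat ((k - 1) * r)"
    using r(1) by (simp only: dexp_def mult_0_right power_0 data_snd.simps)
  \<comment> \<open>The fold runs for \<open>d\<close> rounds. Had each of them raised the exponent,
    then \<open>r = d\<close>, and \<open>2 ^ (k * d) \<le> d\<close> is impossible.\<close>
  moreover have "d < 2 ^ d" by simp
  then have "d < 2 ^ (k * d)"
    by (rule less_le_trans) (use assms in \<open>auto intro!: power_increasing\<close>)
  then have "d < 2 ^ (k * Suc r)" using r(2,3) by auto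
  ultimately show ?thesis using that r(2) by blast
qed

section \<open>Selecting edges by blocks of coins\<close>

definition dall :: "data \<Rightarrow> data \<Rightarrow> data" where
  "dall j w = data_snd (dfold (\<lambda>z. Node (data_snd (data_fst (data_snd (data_snd z))))
      (if data_fst (data_fst (data_snd (data_snd z))) \<noteq> Atom then data_snd (data_snd (data_snd z)) else Atom))
      Atom j (Node w (Node Atom Atom)))"

lemma ptime_dall [ptime_intros]: "ptime f \<Longrightarrow> ptime g \<Longrightarrow> ptime (\<lambda>x. dall (f x) (g x))"
  unfolding dall_def
proof (rule ptime_snd, rule ptime_dfold[where b = 1], goal_cases)
  case (5 c e a)
  show ?case by (cases a; cases "data_fst a") auto
qed (auto intro!: ptime_intros)

text \<open>An exhausted coin list reads as false because \<open>data_fst Atom = Atom\<close>; this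
  is the origin of \<open>j \<le> length bs\<close>.\<close>

lemma dall_enc_list:
  "dall (enc_nat j) (enc_list enc_bool bs) \<noteq> Atom \<longleftrightarrow> j \<le> length bs \<and> list_all id (take j bs)"
proof -
  have "data_snd (dfold (\<lambda>z. Node (data_snd (data_fst (data_snd (data_snd z))))
      (if data_fst (data_fst (data_snd (data_snd z))) \<noteq> Atom then data_snd (data_snd (data_snd z)) else Atom))
      Atom (enc_nat j) (Node (enc_list enc_bool bs) f)) \<noteq> Atom \<longleftrightarrow>
      j \<le> length bs \<and> list_all id (take j bs) \<and> f \<noteq> Atom" for f
  proof (induction j arbitrary: bs f)
    case (Suc j)
    show ?case
      using Suc[of "[]"] Suc[of "tl bs"] by (cases bs) (auto simp: enc_bool_def)
  qed simp
  then show ?thesis by (simp add: dall_def)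
qed

text \<open>A block of \<open>j\<close> fair coins, all showing heads, realises the rate
  \<open>2 ^ -j\<close> exactly. The length test follows \<open>dall\<close>, so that program and
  specification agree on every coin list.\<close>

primrec sel :: "nat \<Rightarrow> bool list \<Rightarrow> 'a list \<Rightarrow> 'a list" where
  "sel j bs [] = []"
| "sel j bs (e # es) =
     (if j \<le> length bs \<and> list_all id (take j bs) then [e] else []) @ sel j (drop j bs) es"

definition dsel :: "data \<Rightarrow> data \<Rightarrow> data \<Rightarrow> data" where
  "dsel j w l = data_snd (dfold (\<lambda>z. Node (ddrop (data_fst z) (data_fst (data_snd (data_snd z))))
     (if dall (data_fst z) (data_fst (data_snd (data_snd z))) \<noteq> Atom
      then Node (data_fst (data_snd z)) (data_snd (data_snd (data_snd z)))
      else data_snd (data_snd (data_snd z)))) j l (Node w Atom))"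

lemma ptime_dsel [ptime_intros]:
  "ptime f \<Longrightarrow> ptime g \<Longrightarrow> ptime h \<Longrightarrow> ptime (\<lambda>x. dsel (f x) (g x) (h x))"
  unfolding dsel_def
proof (rule ptime_snd, rule ptime_dfold[where b = "[:2, 1:]"], goal_cases)
  case (5 c e a)
  show ?case
    using size_ddrop[of c "data_fst a"] by (cases a) auto
qed (auto intro!: ptime_intros)

text \<open>The fold pushes what it keeps, hence the \<open>rev\<close>, which reappears as
  \<open>rev F\<close> in \<open>sparsify\<close>.\<close>

lemma dsel_enc_list:
  "dsel (enc_nat j) (enc_list enc_bool bs) (enc_list f es) = enc_list f (rev (sel j bs es))"
proof -
  have "data_snd (dfold (\<lambda>z. Node (ddrop (data_fst z) (data_fst (data_snd (data_snd z))))
     (if dall (data_fst z) (data_fst (data_snd (data_snd z))) \<noteq> Atom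
      then Node (data_fst (data_snd z)) (data_snd (data_snd (data_snd z)))
      else data_snd (data_snd (data_snd z)))) (enc_nat j) (enc_list f es)
      (Node (enc_list enc_bool bs) (enc_list f F))) = enc_list f (rev (sel j bs es) @ F)" for F
  proof (induction es arbitrary: bs F)
    case (Cons e es)
    show ?case
      using Cons[of "drop j bs" F] Cons[of "drop j bs" "e # F"] dall_enc_list[of j bs]
      by (auto simp: ddrop_enc_list)
  qed simp
  from this[of "[]"] show ?thesis by (simp add: dsel_def)
qed

definition dedges :: "data \<Rightarrow> data" where
  "dedges x = data_snd (data_snd (data_snd (data_snd x)))"

definition dnbits :: "nat \<Rightarrow> data \<Rightarrow> data" where
  "dnbits k x = dmul (dexp k (ddegree (dedges x))) (dedges x)"

definition dsparsify :: "nat \<Rightarrow> data \<Rightarrow> data" where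
  "dsparsify k z = Node (data_fst (data_fst z)) (Node (data_fst (data_snd (data_fst z)))
     (Node (data_fst (data_snd (data_snd (data_fst z))))
     (Node (data_fst (data_snd (data_snd (data_snd (data_fst z)))))
       (dgreedy ((k - 2) div 2) (dsel (dexp k (ddegree (dedges (data_fst z)))) (data_snd z) (dedges (data_fst z)))))))"

lemma ptime_dnbits: "ptime (dnbits k)"
  unfolding dnbits_def[abs_def] dedges_def by (intro ptime_intros)

lemma ptime_dsparsify: "ptime (dsparsify k)"
  unfolding dsparsify_def[abs_def] dedges_def by (intro ptime_intros)

section \<open>Random sublists\<close>

primrec subs :: "real \<Rightarrow> 'a list \<Rightarrow> 'a list pmf" where
  "subs p [] = return_pmf []"
| "subs p (e # es) =
     bernoulli_pmf p \<bind> (\<lambda>b. map_pmf (\<lambda>F. if b then e # F else F) (subs p es))"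

lemma bernoulli_pmf_conj:
  assumes "0 \<le> p" "p \<le> 1" "0 \<le> q" "q \<le> 1"
  shows "bernoulli_pmf p \<bind> (\<lambda>b. map_pmf ((\<and>) b) (bernoulli_pmf q)) = bernoulli_pmf (p * q)"
proof -
  have pq: "0 \<le> p * q" "p * q \<le> 1" using assms by (auto intro: mult_le_one)
  have t: "map_pmf ((\<and>) True) (bernoulli_pmf q) = bernoulli_pmf q" by (simp add: map_pmf_idI)
  have f: "map_pmf ((\<and>) False) (bernoulli_pmf q) = return_pmf False"
  proof -
    have "((\<and>) False) = (\<lambda>_. False)" by auto
    then show ?thesis by (simp only: map_pmf_const)
  qed
  show ?thesis
  proof (rule pmf_eqI)
    fix b show "pmf (bernoulli_pmf p \<bind> (\<lambda>b. map_pmf ((\<and>) b) (bernoulli_pmf q))) b = pmf (bernoulli_pmf (p * q)) b"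
      using assms pq t f by (cases b) (auto simp: pmf_bind algebra_simps)
  qed
qed

lemma map_list_all_flips: "map_pmf (list_all id) (flips j) = bernoulli_pmf ((1/2) ^ j)"
proof (induction j)
  case 0
  show ?case by (rule pmf_eqI) (auto simp: indicator_def)
next
  case (Suc j)
  have "map_pmf (list_all id) (flips (Suc j)) =
      bernoulli_pmf (1/2) \<bind> (\<lambda>b. map_pmf ((\<and>) b) (map_pmf (list_all id) (flips j)))"
    by (simp add: map_pmf_def bind_assoc_pmf bind_return_pmf)
  also have "\<dots> = bernoulli_pmf (1/2 * (1/2) ^ j)"
    unfolding Suc.IH by (rule bernoulli_pmf_conj) (auto simp: power_le_one)
  finally show ?case unfolding power_Suc .
qed

text \<open>Disjoint blocks of coins are independent, so selection by blocks is independent sampling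
  of the edges.\<close>

lemma map_sel_flips: "map_pmf (\<lambda>bs. sel j bs es) (flips (length es * j)) = subs ((1/2) ^ j) es"
proof (induction es)
  case (Cons e es)
  let ?h = "\<lambda>b F. if b then e # F else F"
  have "map_pmf (\<lambda>bs. sel j bs (e # es)) (flips (length (e # es) * j)) =
     flips j \<bind> (\<lambda>bs. flips (length es * j) \<bind> (\<lambda>cs. return_pmf (sel j (bs @ cs) (e # es))))"
    by (simp add: replicate_pmf_distrib map_pmf_def bind_assoc_pmf bind_return_pmf)
  also have "\<dots> = flips j \<bind> (\<lambda>bs. flips (length es * j) \<bind> (\<lambda>cs. return_pmf (?h (list_all id bs) (sel j cs es))))"
    by (intro bind_pmf_cong refl) (auto simp: set_replicate_pmf)
  also have "\<dots> = map_pmf (list_all id) (flips j) \<bind>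
      (\<lambda>b. map_pmf (?h b) (map_pmf (\<lambda>cs. sel j cs es) (flips (length es * j))))"
    by (simp add: map_pmf_def bind_assoc_pmf bind_return_pmf)
  finally show ?case by (simp add: Cons map_list_all_flips)
qed simp

lemma set_pmf_subs:
  assumes "F \<in> set_pmf (subs p es)"
  shows "set F \<subseteq> set es" "distinct es \<Longrightarrow> distinct F"
proof -
  have "set F \<subseteq> set es \<and> (distinct es \<longrightarrow> distinct F)"
    using assms by (induction es arbitrary: F) (fastforce split: if_splits)+
  then show "set F \<subseteq> set es" "distinct es \<Longrightarrow> distinct F" by auto
qed

lemma finite_set_pmf_subs: "finite (set_pmf (subs p es))"
  by (induction es) auto

lemma integrable_subs [simp]: "integrable (measure_pmf (subs p es)) (f :: _ \<Rightarrow> real)"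
  by (rule integrable_measure_pmf_finite[OF finite_set_pmf_subs])

text \<open>Independence in a single formula. With \<open>f = 1\<close> and \<open>g\<close>
  vanishing exactly on \<open>S\<close> it gives the probability of
  \<open>S \<subseteq> set F\<close>; with \<open>g = 1\<close>, the value 2 of \<open>f\<close> on
  \<open>S\<close> or 1/2 everywhere gives the exponential moments for the two tail bounds.\<close>

lemma expectation_subs_prod:
  fixes f g :: "'a \<Rightarrow> real"
  assumes "distinct es" "0 \<le> p" "p \<le> 1"
  shows "measure_pmf.expectation (subs p es) (\<lambda>F. \<Prod>e\<in>set es. if e \<in> set F then f e else g e) =
    (\<Prod>e\<in>set es. p * f e + (1 - p) * g e)"
  using assms(1)
proof (induction es)
  case (Cons e es)
  let ?u = "\<lambda>F. \<Prod>e\<in>set es. if e \<in> set F then f e else g e"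
  let ?v = "\<lambda>F. \<Prod>e'\<in>set (e # es). if e' \<in> set F then f e' else g e'"
  have v: "?v (if b then e # F else F) = (if b then f e else g e) * ?u F" if "F \<in> set_pmf (subs p es)" for b F
  proof -
    have "e \<notin> set F" using set_pmf_subs(1)[OF that] Cons.prems by auto
    moreover have "(\<Prod>e'\<in>set es. if e' = e \<or> e' \<in> set F then f e' else g e') = ?u F"
      using Cons.prems by (intro prod.cong) auto
    ultimately show ?thesis using Cons.prems by simp
  qed
  have "measure_pmf.expectation (subs p (e # es)) ?v = (\<Sum>b\<in>UNIV. pmf (bernoulli_pmf p) b *\<^sub>R
      measure_pmf.expectation (map_pmf (\<lambda>F. if b then e # F else F) (subs p es)) ?v)"
    unfolding subs.simps
    by (rule pmf_expectation_bind) (auto intro: finite_set_pmf_subs)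
  also have "\<dots> = (\<Sum>b\<in>UNIV. pmf (bernoulli_pmf p) b *\<^sub>R
      measure_pmf.expectation (subs p es) (\<lambda>F. (if b then f e else g e) * ?u F))"
    unfolding integral_map_pmf
    by (intro sum.cong refl arg_cong2[where f = "(*\<^sub>R)"] integral_cong_AE AE_pmfI v) auto
  also have "\<dots> = (p * f e + (1 - p) * g e) * measure_pmf.expectation (subs p es) ?u"
    using assms by (simp add: UNIV_bool algebra_simps)
  finally show ?case using Cons by simp
qed simp

lemma Markov_pmf:
  fixes u :: "'a \<Rightarrow> real"
  assumes "finite (set_pmf M)" "\<And>x. 0 \<le> u x" "0 < t"
  shows "measure_pmf.prob M {x. t \<le> u x} \<le> measure_pmf.expectation M u / t"
  using integral_Markov_inequality_measure[of "measure_pmf M" u UNIV t] assms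
  by (auto simp: integrable_measure_pmf_finite)

lemma prob_subset_subs:
  assumes "distinct es" "0 \<le> p" "p \<le> 1" "S \<subseteq> set es"
  shows "measure_pmf.prob (subs p es) {F. S \<subseteq> set F} = p ^ card S"
proof -
  have "(indicator {F. S \<subseteq> set F} :: _ \<Rightarrow> real) =
      (\<lambda>F. \<Prod>e\<in>set es. if e \<in> set F then 1 else if e \<in> S then 0 else 1)"
  proof
    fix F
    show "indicator {F. S \<subseteq> set F} F = (\<Prod>e\<in>set es. if e \<in> set F then 1 else if e \<in> S then 0 else (1::real))"
    proof (cases "S \<subseteq> set F")
      case True
      then have "(\<Prod>e\<in>set es. if e \<in> set F then 1 else if e \<in> S then 0 else (1::real)) = 1"
        by (intro prod.neutral) auto
      then show ?thesis using True by simp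
    next
      case False
      then obtain e where "e \<in> S" "e \<notin> set F" by auto
      then have "(\<Prod>e\<in>set es. if e \<in> set F then 1 else if e \<in> S then 0 else (1::real)) = 0"
        using assms(4) by (intro prod_zero) (auto intro!: bexI[of _ e])
      then show ?thesis using False by simp
    qed
  qed
  then have "measure_pmf.expectation (subs p es) (indicator {F. S \<subseteq> set F}) =
      (\<Prod>e\<in>set es. p * 1 + (1 - p) * (if e \<in> S then 0 else 1))"
    by (simp only: expectation_subs_prod[OF assms(1-3)])
  also have "\<dots> = (\<Prod>e\<in>set es. if e \<in> S then p else 1)" by (intro prod.cong) auto
  also have "\<dots> = p ^ card S"
    using assms(4) by (simp add: prod.If_cases Int_absorb1)
  finally show ?thesis by simp
qed

text \<open>Chernoff's method: Markov's inequality for \<open>2 ^ X\<close> with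
  \<open>X = card (S \<inter> set F)\<close>, whose expectation is
  \<open>(1 + p) ^ card S \<le> exp (p * m)\<close>.\<close>

lemma prob_many_subs:
  assumes "distinct es" "0 \<le> p" "p \<le> 1" "S \<subseteq> set es" "real (card S) \<le> m"
  shows "measure_pmf.prob (subs p es) {F. \<tau> < real (card (S \<inter> set F))} \<le> exp (p * m) / 2 powr \<tau>"
proof -
  let ?u = "\<lambda>F. \<Prod>e\<in>set es. if e \<in> set F then (if e \<in> S then 2 else 1) else (1::real)"
  have u: "?u F = 2 powr real (card (S \<inter> set F))" for F
  proof -
    have *: "set es \<inter> {e. e \<in> S \<inter> set F} = S \<inter> set F" using assms(4) by auto
    have "?u F = (\<Prod>e\<in>set es. if e \<in> S \<inter> set F then 2 else 1)" by (intro prod.cong) auto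
    also have "\<dots> = 2 ^ card (S \<inter> set F)"
      by (simp only: prod.If_cases[OF finite_set] *) simp
    finally show ?thesis by (simp add: powr_realpow)
  qed
  have "measure_pmf.prob (subs p es) {F. \<tau> < real (card (S \<inter> set F))} \<le>
      measure_pmf.prob (subs p es) {F. 2 powr \<tau> \<le> ?u F}"
    unfolding u by (intro measure_pmf.finite_measure_mono) auto
  also have "\<dots> \<le> measure_pmf.expectation (subs p es) ?u / 2 powr \<tau>"
    by (rule Markov_pmf[OF finite_set_pmf_subs]) (auto intro: prod_nonneg)
  also have "measure_pmf.expectation (subs p es) ?u = (\<Prod>e\<in>set es. p * (if e \<in> S then 2 else 1) + (1 - p) * 1)"
    by (rule expectation_subs_prod[OF assms(1-3)])
  also have "\<dots> = (\<Prod>e\<in>set es. if e \<in> S then 1 + p else 1)" by (intro prod.cong) auto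
  also have "\<dots> = (1 + p) ^ card S"
    using assms(4) by (simp add: prod.If_cases Int_absorb1)
  also have "\<dots> \<le> exp p ^ card S" using assms by (intro power_mono) auto
  also have "\<dots> = exp (p * real (card S))" by (simp add: exp_of_nat_mult[symmetric] mult.commute)
  also have "\<dots> \<le> exp (p * m)" using assms by (auto intro: mult_left_mono)
  finally show ?thesis by (simp add: divide_right_mono)
qed

lemma prob_many_subs_union:
  assumes "distinct es" "0 \<le> p" "p \<le> 1" "finite \<S>"
    and "\<And>S. S \<in> \<S> \<Longrightarrow> S \<subseteq> set es \<and> real (card S) \<le> m"
  shows "measure_pmf.prob (subs p es) {F. \<exists>S\<in>\<S>. \<tau> < real (card (S \<inter> set F))} \<le>
    real (card \<S>) * (exp (p * m) / 2 powr \<tau>)"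
proof -
  have "{F. \<exists>S\<in>\<S>. \<tau> < real (card (S \<inter> set F))} = (\<Union>S\<in>\<S>. {F. \<tau> < real (card (S \<inter> set F))})" by auto
  then have "measure_pmf.prob (subs p es) {F. \<exists>S\<in>\<S>. \<tau> < real (card (S \<inter> set F))} \<le>
      (\<Sum>S\<in>\<S>. measure_pmf.prob (subs p es) {F. \<tau> < real (card (S \<inter> set F))})"
    using assms(4) by (simp add: measure_pmf.finite_measure_subadditive_finite)
  also have "\<dots> \<le> (\<Sum>S\<in>\<S>. exp (p * m) / 2 powr \<tau>)"
    using assms by (intro sum_mono prob_many_subs) auto
  finally show ?thesis by simp
qed

text \<open>Lower tail by Markov's inequality for \<open>(1/2) ^ X\<close>, \<open>X\<close> the
  number of kept edges. For \<open>t = length es * p / 4\<close> the expectation is at most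
  \<open>exp (- 2 * t)\<close>, and the threshold \<open>(1/2) powr t\<close> costs at most
  \<open>exp t\<close> since \<open>ln 2 \<le> 1\<close>.\<close>

lemma prob_few_subs:
  fixes p :: real
  assumes "distinct es" "0 \<le> p" "p \<le> 1"
  shows "measure_pmf.prob (subs p es) {F. real (card (set F)) < length es * p / 4} \<le> exp (- (length es * p / 4))"
proof -
  let ?t = "length es * p / 4"
  let ?u = "\<lambda>F. \<Prod>e\<in>set es. if e \<in> set F then 1/2 else (1::real)"
  have u: "?u F = (1/2) powr real (card (set F))" if "F \<in> set_pmf (subs p es)" for F
  proof -
    have "set F \<subseteq> set es" using set_pmf_subs(1)[OF that] .
    then show ?thesis by (simp add: prod.If_cases Int_absorb1 powr_realpow)
  qed
  have "measure_pmf.prob (subs p es) {F. real (card (set F)) < ?t} =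
      measure_pmf.prob (subs p es) ({F. real (card (set F)) < ?t} \<inter> set_pmf (subs p es))"
    by (simp add: measure_Int_set_pmf)
  also have "\<dots> \<le> measure_pmf.prob (subs p es) {F. (1/2) powr ?t \<le> ?u F}"
    by (intro measure_pmf.finite_measure_mono) (auto simp: u powr_mono')
  also have "\<dots> \<le> measure_pmf.expectation (subs p es) ?u / (1/2) powr ?t"
    by (rule Markov_pmf[OF finite_set_pmf_subs]) (auto intro: prod_nonneg)
  also have "measure_pmf.expectation (subs p es) ?u = (\<Prod>e\<in>set es. p * (1/2) + (1 - p) * 1)"
    by (rule expectation_subs_prod[OF assms])
  also have "\<dots> = (1 + (- p / 2)) ^ length es"
    using assms(1) by (simp add: distinct_card algebra_simps)
  also have "\<dots> \<le> exp (- p / 2) ^ length es" using assms by (intro power_mono exp_ge_add_one_self) auto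
  also have "\<dots> = exp (- (2 * ?t))" by (simp add: exp_of_nat_mult[symmetric])
  also have "exp (- (2 * ?t)) / (1/2) powr ?t \<le> exp (- ?t)"
  proof -
    have "ln 2 \<le> (1::real)" using ln_le_minus_one[of "2::real"] by simp
    then have "?t * ln 2 \<le> ?t" using assms by (simp add: mult_left_le)
    then have "exp (- (2 * ?t)) * exp (?t * ln 2) \<le> exp (- ?t)"
      unfolding exp_add[symmetric] exp_le_cancel_iff by linarith
    moreover have "inverse ((1/2) powr ?t) = exp (?t * ln 2)" by (simp add: powr_def ln_div exp_minus)
    ultimately show ?thesis by (simp only: divide_inverse)
  qed
  finally show ?thesis by (simp add: divide_right_mono)
qed

text \<open>First moment bound: the number of edges with a surviving witness is at most the number
  of surviving witnesses. The witnesses in \<open>C e\<close> will be the short cycles through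
  \<open>e\<close>, and \<open>T x\<close> the edges of such a cycle.\<close>

lemma prob_many_covered_subs:
  fixes T :: "'b \<Rightarrow> 'a set"
  assumes "distinct es" "0 \<le> p" "p \<le> 1" "0 < \<tau>"
    and "\<And>e. e \<in> set es \<Longrightarrow> finite (C e)"
    and "\<And>e x. e \<in> set es \<Longrightarrow> x \<in> C e \<Longrightarrow> T x \<subseteq> set es"
  shows "measure_pmf.prob (subs p es) {F. \<tau> \<le> real (card {e \<in> set es. \<exists>x\<in>C e. T x \<subseteq> set F})} \<le>
    (\<Sum>e\<in>set es. \<Sum>x\<in>C e. p ^ card (T x)) / \<tau>"
proof -
  let ?u = "\<lambda>F. \<Sum>e\<in>set es. \<Sum>x\<in>C e. indicator {F. T x \<subseteq> set F} F :: real"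
  have le: "real (card {e \<in> set es. \<exists>x\<in>C e. T x \<subseteq> set F}) \<le> ?u F" for F
  proof -
    have "real (card {e \<in> set es. \<exists>x\<in>C e. T x \<subseteq> set F}) =
        (\<Sum>e\<in>set es. if \<exists>x\<in>C e. T x \<subseteq> set F then 1 else 0)"
      by (simp add: sum.If_cases Int_def)
    also have "\<dots> \<le> ?u F"
    proof (rule sum_mono)
      fix e assume e: "e \<in> set es"
      show "(if \<exists>x\<in>C e. T x \<subseteq> set F then 1 else 0) \<le> (\<Sum>x\<in>C e. indicator {F. T x \<subseteq> set F} F :: real)"
      proof (cases "\<exists>x\<in>C e. T x \<subseteq> set F")
        case True
        then obtain x where "x \<in> C e" "T x \<subseteq> set F" by blast
        then show ?thesis
          using member_le_sum[of x "C e" "\<lambda>x. indicator {F. T x \<subseteq> set F} F :: real"] assms(5)[OF e] by auto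
      qed (auto intro: sum_nonneg)
    qed
    finally show ?thesis .
  qed
  have "measure_pmf.prob (subs p es) {F. \<tau> \<le> real (card {e \<in> set es. \<exists>x\<in>C e. T x \<subseteq> set F})} \<le>
      measure_pmf.prob (subs p es) {F. \<tau> \<le> ?u F}"
    using le by (intro measure_pmf.finite_measure_mono) (auto intro: order.trans)
  also have "\<dots> \<le> measure_pmf.expectation (subs p es) ?u / \<tau>"
    by (rule Markov_pmf[OF finite_set_pmf_subs _ assms(4)]) (auto intro: sum_nonneg)
  also have "measure_pmf.expectation (subs p es) ?u =
      (\<Sum>e\<in>set es. \<Sum>x\<in>C e. measure_pmf.prob (subs p es) {F. T x \<subseteq> set F})"
    by (simp add: Bochner_Integration.integral_sum)
  also have "\<dots> = (\<Sum>e\<in>set es. \<Sum>x\<in>C e. p ^ card (T x))"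
    using assms by (intro sum.cong refl prob_subset_subs) auto
  finally show ?thesis .
qed

section \<open>Short cycles in bipartite graphs\<close>

definition bip :: "('a \<times> 'b) set \<Rightarrow> ('a + 'b) set set" where
  "bip E = (\<lambda>(a, b). {Inl a, Inr b}) ` E"

definition adj :: "('a \<times> 'b) set \<Rightarrow> 'a + 'b \<Rightarrow> 'a + 'b \<Rightarrow> bool" where
  "adj E u v \<longleftrightarrow> {u, v} \<in> bip E"

lemma adj_simps [simp]:
  "adj E (Inl a) (Inr b) \<longleftrightarrow> (a, b) \<in> E" "adj E (Inr b) (Inl a) \<longleftrightarrow> (a, b) \<in> E"
  "\<not> adj E (Inl a) (Inl a')" "\<not> adj E (Inr b) (Inr b')"
  by (auto simp: adj_def bip_def doubleton_eq_iff image_iff)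

lemma adj_commute: "adj E u v \<longleftrightarrow> adj E v u"
  by (simp add: adj_def insert_commute)

lemma bip_mono: "E \<subseteq> E' \<Longrightarrow> bip E \<subseteq> bip E'"
  by (auto simp: bip_def)

lemma edge_in_bip_iff: "{Inl a, Inr b} \<in> bip E \<longleftrightarrow> (a, b) \<in> E"
  by (auto simp: bip_def doubleton_eq_iff image_iff)

text \<open>Going back and forth along the edge pads it to \<open>2 * h + 1\<close> edges; this is
  why testing a single walk length also catches all shorter paths.\<close>

lemma walk_edge: "(a, b) \<in> E \<Longrightarrow> walk E h a b"
  by (induction h) auto

lemma walk_imp_path:
  assumes "walk E i a b"
  shows "\<exists>xs. successively (adj E) xs \<and> xs \<noteq> [] \<and> hd xs = Inl a \<and> last xs = Inr b \<and> length xs = 2 * i + 2"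
  using assms
proof (induction i arbitrary: a)
  case 0
  then show ?case by (intro exI[of _ "[Inl a, Inr b]"]) auto
next
  case (Suc i)
  then obtain b' a' where e: "(a, b') \<in> E" "(a', b') \<in> E" "walk E i a' b" by auto
  from Suc.IH[OF e(3)] obtain xs where "successively (adj E) xs" "xs \<noteq> []" "hd xs = Inl a'"
    "last xs = Inr b" "length xs = 2 * i + 2" by blast
  then show ?case using e
    by (intro exI[of _ "Inl a # Inr b' # xs"]) (auto simp: successively_Cons)
qed

text \<open>Cut out the segment between two occurrences of a vertex and repeat.\<close>

lemma distinct_path:
  assumes "successively R xs" "xs \<noteq> []"
  shows "\<exists>ys. successively R ys \<and> ys \<noteq> [] \<and> distinct ys \<and> hd ys = hd xs \<and> last ys = last xs \<and>
    length ys \<le> length xs"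
  using assms
proof (induction "length xs" arbitrary: xs rule: less_induct)
  case less
  show ?case
  proof (cases "distinct xs")
    case False
    then obtain us y vs ws where xs: "xs = us @ [y] @ vs @ [y] @ ws" using not_distinct_decomp by blast
    let ?ys = "us @ [y] @ ws"
    have "successively R ?ys"
      using less.prems(1) unfolding xs by (auto simp: successively_append_iff successively_Cons)
    moreover have "length ?ys < length xs" "hd ?ys = hd xs" "last ?ys = last xs" "?ys \<noteq> []"
      by (auto simp: xs hd_append)
    ultimately show ?thesis using less.hyps[of ?ys] by (metis order.trans less_imp_le)
  qed (use less.prems in blast)
qed

text \<open>A walk with parameter \<open>h\<close> visits \<open>2 * h + 2\<close> vertices. The
  bound can be one larger because a path between opposite sides has an even number of vertices; for
  odd \<open>k\<close> this covers length \<open>k\<close> itself.\<close>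

lemma path_imp_walk:
  assumes "successively (adj E) xs" "xs \<noteq> []" "hd xs = Inl a" "last xs = Inr b" "length xs \<le> 2 * h + 3"
  shows "walk E h a b"
  using assms
proof (induction h arbitrary: a xs)
  case 0
  from 0(2,3) obtain xs1 where x1: "xs = Inl a # xs1" by (cases xs) auto
  with 0(4) obtain y xs2 where x2: "xs1 = y # xs2" by (cases xs1) auto
  obtain b' where y: "y = Inr b'" using 0(1) x1 x2 by (cases y) auto
  show ?case
  proof (cases xs2)
    case Nil
    then show ?thesis using 0 x1 x2 y by auto
  next
    case (Cons z zs)
    then show ?thesis using 0 x1 x2 y by (cases z) auto
  qed
next
  case (Suc h)
  from Suc.prems(2,3) obtain xs1 where x1: "xs = Inl a # xs1" by (cases xs) auto
  with Suc.prems(4) obtain y xs2 where x2: "xs1 = y # xs2" by (cases xs1) auto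
  obtain b' where y: "y = Inr b'" using Suc.prems(1) x1 x2 by (cases y) auto
  show ?case
  proof (cases xs2)
    case Nil
    then show ?thesis using Suc.prems x1 x2 y by (intro walk_edge) auto
  next
    case (Cons z zs)
    then obtain a' where z: "z = Inl a'" using Suc.prems(1) x1 x2 y by (cases z) auto
    have "walk E h a' b"
      using Suc.prems x1 x2 y Cons z by (intro Suc.IH[of xs2]) auto
    then show ?thesis using Suc.prems(1) x1 x2 y Cons z by auto
  qed
qed

text \<open>Equal pairs at different positions would make each position the cyclic successor of the
  other, so the length would divide 2.\<close>

lemma cyclic_pair_inj:
  assumes "distinct vs" "3 \<le> length vs" "i < length vs" "j < length vs"
    and "{vs ! i, vs ! (Suc i mod length vs)} = {vs ! j, vs ! (Suc j mod length vs)}"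
  shows "i = j"
proof (rule ccontr)
  let ?n = "length vs"
  assume "i \<noteq> j"
  have lt: "Suc i mod ?n < ?n" "Suc j mod ?n < ?n" using assms(2) by (auto intro!: mod_less_divisor)
  have "vs ! i \<noteq> vs ! j" using \<open>i \<noteq> j\<close> assms by (simp add: nth_eq_iff_index_eq)
  then have "vs ! i = vs ! (Suc j mod ?n)" "vs ! (Suc i mod ?n) = vs ! j"
    using assms(5) by (auto simp: doubleton_eq_iff)
  then have "i = Suc j mod ?n" "Suc i mod ?n = j"
    using assms lt by (simp_all add: nth_eq_iff_index_eq)
  then show False using assms(2-4) by (auto simp: mod_Suc split: if_splits)
qed

text \<open>The cycle must use the new edge, and by \<open>cyclic_pair_inj\<close> only once.
  Rotated so that this edge joins the last vertex to the first, it is a path in the old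
  graph.\<close>

lemma is_cycle_insert:
  assumes "is_cycle (bip (insert (a, b) E)) vs" "\<not> is_cycle (bip E) vs"
  shows "\<exists>xs. successively (adj E) xs \<and> xs \<noteq> [] \<and> hd xs = Inl a \<and> last xs = Inr b \<and> length xs = length vs"
proof -
  let ?n = "length vs"
  let ?p = "\<lambda>i. {vs ! i, vs ! (Suc i mod ?n)}"
  have n: "3 \<le> ?n" and d: "distinct vs" and e: "\<And>i. i < ?n \<Longrightarrow> ?p i \<in> insert {Inl a, Inr b} (bip E)"
    using assms(1) by (auto simp: is_cycle_def bip_def)
  from assms(2) n d obtain i where i: "i < ?n" "?p i \<notin> bip E" by (auto simp: is_cycle_def)
  then have pi: "?p i = {Inl a, Inr b}" using e by blast
  define ys where "ys = rotate (Suc i) vs"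
  have len: "length ys = ?n" by (simp add: ys_def)
  have nth: "ys ! j = vs ! ((Suc i + j) mod ?n)" if "j < ?n" for j
    unfolding ys_def using that by (rule nth_rotate)
  have "adj E (ys ! j) (ys ! Suc j)" if "Suc j < ?n" for j
  proof -
    define m where "m = (Suc i + j) mod ?n"
    have m: "m < ?n" unfolding m_def using n by (intro mod_less_divisor) auto
    have "Suc m mod ?n = (Suc i + Suc j) mod ?n" by (simp add: m_def mod_Suc_eq)
    then have *: "{ys ! j, ys ! Suc j} = ?p m" using that nth by (simp add: m_def)
    have "m \<noteq> i"
      using i(1) that by (cases "Suc i + j < ?n") (auto simp: m_def mod_if)
    then have "?p m \<noteq> {Inl a, Inr b}" using cyclic_pair_inj[OF d n m i(1)] pi by auto
    then show ?thesis using e[OF m] * by (auto simp: adj_def)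
  qed
  then have succ: "successively (adj E) ys" by (simp add: successively_conv_nth len)
  have ne: "ys \<noteq> []" "vs \<noteq> []" using len n by auto
  have h: "hd ys = vs ! (Suc i mod ?n)" using nth[of 0] ne len by (auto simp: hd_conv_nth)
  have "Suc i + (?n - 1) = i + ?n" using n by simp
  then have "(Suc i + (?n - 1)) mod ?n = i" using i(1) by (simp only: mod_add_self2 mod_less)
  then have l: "last ys = vs ! i" using nth[of "?n - 1"] ne n len by (simp add: last_conv_nth)
  \<comment> \<open>The cycle may traverse the new edge in either direction; in the second case the
    path is reversed.\<close>
  from pi h l consider "hd ys = Inl a" "last ys = Inr b" | "hd ys = Inr b" "last ys = Inl a"
    by (auto simp: doubleton_eq_iff)
  then show ?thesis
  proof cases
    case 1
    then show ?thesis using succ ne len by blast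
  next
    case 2
    have "successively (adj E) (rev ys)"
      unfolding successively_rev using succ by (simp add: adj_commute[of E])
    then show ?thesis using 2 ne len by (intro exI[of _ "rev ys"]) (auto simp: hd_rev last_rev)
  qed
qed

section \<open>Greedy insertion and short cycles\<close>

lemma greedy_snoc:
  "greedy h (es @ [(a, b)]) =
    (if walk (set (greedy h es)) h a b then greedy h es else (a, b) # greedy h es)"
  by (simp add: greedy_def)

lemma greedy_Nil [simp]: "greedy h [] = []"
  by (simp add: greedy_def)

lemma set_greedy: "set (greedy h es) \<subseteq> set es"
proof (induction es rule: rev_induct)
  case (snoc e es)
  then show ?case by (cases e) (auto simp: greedy_snoc)
qed simp

lemma distinct_greedy: "distinct es \<Longrightarrow> distinct (greedy h es)"
proof (induction es rule: rev_induct)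
  case (snoc e es)
  then show ?case using set_greedy[of h es] by (cases e) (auto simp: greedy_snoc)
qed simp

lemma not_walk_empty: "\<not> walk {} h a b"
  by (cases h) auto

text \<open>The first edge inserted always survives. This keeps the new instance well-formed, which
  requires an edge.\<close>

lemma greedy_eq_Nil_iff: "greedy h es = [] \<longleftrightarrow> es = []"
proof (induction es rule: rev_induct)
  case (snoc e es)
  then show ?case by (cases e) (auto simp: greedy_snoc not_walk_empty)
qed simp

text \<open>Consider the last edge inserted. A new cycle through it leaves a path between its ends;
  with at most \<open>2 * h + 3\<close> vertices, that path would have made the walk test reject the
  edge.\<close>

lemma greedy_no_short_cycle:
  assumes "is_cycle (bip (set (greedy h es))) vs"
  shows "2 * h + 3 < length vs"
  using assms
proof (induction es rule: rev_induct)
  case Nil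
  then have "3 \<le> length vs" "\<And>i. \<not> i < length vs" by (auto simp: is_cycle_def bip_def)
  from this(1) this(2)[of 0] show ?case by simp
next
  case (snoc e es)
  obtain a b where e: "e = (a, b)" by force
  let ?G = "set (greedy h es)"
  show ?case
  proof (cases "walk ?G h a b \<or> is_cycle (bip ?G) vs")
    case True
    then show ?thesis using snoc e by (auto simp: greedy_snoc)
  next
    case False
    then have "is_cycle (bip (insert (a, b) ?G)) vs" using snoc.prems by (simp add: e greedy_snoc)
    from is_cycle_insert[OF this] False obtain xs where "successively (adj ?G) xs" "xs \<noteq> []"
        "hd xs = Inl a" "last xs = Inr b" "length xs = length vs"
      by blast
    then show ?thesis using path_imp_walk[of ?G xs a b h] False by fastforce
  qed
qed

lemma is_cycle_mono: "is_cycle G vs \<Longrightarrow> G \<subseteq> G' \<Longrightarrow> is_cycle G' vs"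
  by (auto simp: is_cycle_def)

text \<open>Shortened to a path, the walk that caused the rejection closes up with the rejected
  edge. Greedy insertion starts from a subset of the kept edges, so the cycle lives in the sample
  and does not depend on later decisions.\<close>

lemma greedy_removed:
  assumes "distinct es" "(a, b) \<in> set es" "(a, b) \<notin> set (greedy h es)"
  shows "\<exists>xs. is_cycle (bip (set es)) xs \<and> hd xs = Inl a \<and> last xs = Inr b \<and> length xs \<le> 2 * h + 2"
  using assms
proof (induction es rule: rev_induct)
  case (snoc e es)
  show ?case
  proof (cases "e = (a, b)")
    case False
    obtain a' b' where e: "e = (a', b')" by force
    have "\<exists>xs. is_cycle (bip (set es)) xs \<and> hd xs = Inl a \<and> last xs = Inr b \<and> length xs \<le> 2 * h + 2"
      using snoc False by (intro snoc.IH) (auto simp: e greedy_snoc split: if_splits)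
    then show ?thesis using is_cycle_mono[OF _ bip_mono[of "set es" "set (es @ [e])"]] by auto
  next
    case True
    let ?G = "set (greedy h es)"
    have "walk ?G h a b" using snoc.prems True by (auto simp: greedy_snoc split: if_splits)
    from walk_imp_path[OF this] obtain ys where ys: "successively (adj ?G) ys" "ys \<noteq> []" "hd ys = Inl a"
      "last ys = Inr b" "length ys = 2 * h + 2" by blast
    from distinct_path[OF ys(1,2)] ys obtain xs where xs: "successively (adj ?G) xs" "xs \<noteq> []" "distinct xs"
       "hd xs = Inl a" "last xs = Inr b" "length xs \<le> 2 * h + 2" by auto
    \<comment> \<open>Otherwise the path could be the edge itself, which closes no cycle; this is
      where distinctness of the list enters.\<close>
    have ab: "(a, b) \<notin> ?G" using snoc.prems(1) True set_greedy[of h es] by auto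
    have "3 \<le> length xs"
    proof (rule ccontr)
      assume "\<not> ?thesis"
      then obtain u v where "xs = [u] \<or> xs = [u, v]"
        using xs(2) by (cases xs; cases "tl xs") (auto simp: Suc_le_eq)
      then show False using xs ab by auto
    qed
    moreover have "{xs ! i, xs ! (Suc i mod length xs)} \<in> bip (set (es @ [e]))" if "i < length xs" for i
    proof (cases "Suc i = length xs")
      case True
      then have "i = length xs - 1" "Suc i mod length xs = 0" by simp_all
      then have "xs ! i = Inr b" "xs ! (Suc i mod length xs) = Inl a"
        using xs(2,4,5) by (simp_all add: last_conv_nth hd_conv_nth)
      then show ?thesis using \<open>e = (a, b)\<close> edge_in_bip_iff[of a b "set (es @ [e])"] by (simp add: insert_commute)
    next
      case False
      then have "{xs ! i, xs ! (Suc i mod length xs)} \<in> bip ?G"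
        using xs(1) that by (simp add: successively_conv_nth adj_def)
      then show ?thesis using bip_mono[of ?G "set (es @ [e])"] set_greedy[of h es] by auto
    qed
    ultimately show ?thesis using xs by (auto simp: is_cycle_def)
  qed
qed simp

section \<open>Counting short cycles through an edge\<close>

definition cycle_edges :: "('a + 'b) list \<Rightarrow> ('a \<times> 'b) set" where
  "cycle_edges xs = {(a, b). \<exists>i < length xs. {xs ! i, xs ! (Suc i mod length xs)} = {Inl a, Inr b}}"

lemma cycle_edges_subset:
  assumes "is_cycle (bip E) xs"
  shows "cycle_edges xs \<subseteq> E"
proof clarify
  fix a b assume "(a, b) \<in> cycle_edges xs"
  then obtain i where "i < length xs" "{xs ! i, xs ! (Suc i mod length xs)} = {Inl a, Inr b}"
    unfolding cycle_edges_def by blast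
  then have "{Inl a, Inr b} \<in> bip E" using assms unfolding is_cycle_def by metis
  then show "(a, b) \<in> E" by (simp only: edge_in_bip_iff)
qed

text \<open>Makes \<open>p ^ length xs\<close> the probability that all edges of the cycle are
  sampled.\<close>

lemma card_cycle_edges:
  assumes "is_cycle (bip E) xs"
  shows "card (cycle_edges xs) = length xs"
proof -
  let ?p = "\<lambda>i. {xs ! i, xs ! (Suc i mod length xs)}"
  let ?f = "\<lambda>e. {Inl (fst e), Inr (snd e)}"
  have c: "3 \<le> length xs" "distinct xs" "\<And>i. i < length xs \<Longrightarrow> ?p i \<in> bip E"
    using assms unfolding is_cycle_def by blast+
  have "?f ` cycle_edges xs = ?p ` {..<length xs}"
  proof
    show "?p ` {..<length xs} \<subseteq> ?f ` cycle_edges xs"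
    proof
      fix s assume "s \<in> ?p ` {..<length xs}"
      then obtain i where i: "i < length xs" "s = ?p i" by blast
      from c(3)[OF i(1)] have "s \<in> bip E" by (simp only: i(2))
      then obtain a b where ab: "s = {Inl a, Inr b}" unfolding bip_def by fast
      have "(a, b) \<in> cycle_edges xs" unfolding cycle_edges_def using i(1) i(2)[symmetric] ab by auto
      then show "s \<in> ?f ` cycle_edges xs" using ab by (intro image_eqI[of _ _ "(a, b)"]) simp_all
    qed
    show "?f ` cycle_edges xs \<subseteq> ?p ` {..<length xs}"
    proof
      fix s assume "s \<in> ?f ` cycle_edges xs"
      then obtain a b where ab: "(a, b) \<in> cycle_edges xs" "s = {Inl a, Inr b}" by force
      from ab(1) obtain i where "i < length xs" "?p i = {Inl a, Inr b}"
        unfolding cycle_edges_def by blast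
      with ab(2) have "i < length xs" "s = ?p i" by (simp_all only:)
      then show "s \<in> ?p ` {..<length xs}" by blast
    qed
  qed
  moreover have "inj_on ?f (cycle_edges xs)"
    by (rule inj_onI) (simp add: doubleton_eq_iff prod_eq_iff)
  moreover have "inj_on ?p {..<length xs}"
  proof (rule inj_onI)
    fix i j assume "i \<in> {..<length xs}" "j \<in> {..<length xs}" "?p i = ?p j"
    then show "i = j" using cyclic_pair_inj[OF c(2,1), of i j] by simp
  qed
  ultimately have "card (cycle_edges xs) = card {..<length xs}"
    using card_image[of ?f "cycle_edges xs"] card_image[of ?p "{..<length xs}"] by simp
  then show ?thesis by simp
qed

lemma card_paths_le:
  assumes "\<And>u. finite {v. R u v} \<and> card {v. R u v} \<le> d"
  shows "finite {xs. length xs = Suc m \<and> hd xs = u \<and> successively R xs} \<and>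
    card {xs. length xs = Suc m \<and> hd xs = u \<and> successively R xs} \<le> d ^ m"
proof (induction m arbitrary: u)
  case 0
  have "{xs. length xs = Suc 0 \<and> hd xs = u \<and> successively R xs} = {[u]}"
    by (auto simp: length_Suc_conv)
  then show ?case by simp
next
  case (Suc m)
  let ?W = "\<lambda>u. {xs. length xs = Suc m \<and> hd xs = u \<and> successively R xs}"
  have eq: "{xs. length xs = Suc (Suc m) \<and> hd xs = u \<and> successively R xs} = (\<Union>v\<in>{v. R u v}. (#) u ` ?W v)"
    by (auto simp: length_Suc_conv successively_Cons image_iff)
  have "card (\<Union>v\<in>{v. R u v}. (#) u ` ?W v) \<le> (\<Sum>v\<in>{v. R u v}. card ((#) u ` ?W v))"
    using assms by (intro card_UN_le) auto
  also have "\<dots> \<le> (\<Sum>v\<in>{v. R u v}. d ^ m)"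
    using Suc by (intro sum_mono) (meson card_image_le order.trans)
  also have "\<dots> \<le> d ^ Suc m" using assms by simp
  finally show ?case unfolding eq using assms Suc by auto
qed

text \<open>Both ends are prescribed. Removing the last vertex is injective and leaves a path of
  \<open>m - 2\<close> steps from \<open>u\<close>, with at most \<open>d\<close> choices for
  each.\<close>

lemma card_cycles_le:
  assumes "\<And>u. finite {v. adj E u v} \<and> card {v. adj E u v} \<le> d"
  shows "finite {xs. length xs = m \<and> is_cycle (bip E) xs \<and> hd xs = u \<and> last xs = v} \<and>
    card {xs. length xs = m \<and> is_cycle (bip E) xs \<and> hd xs = u \<and> last xs = v} \<le> d ^ (m - 2)"
    (is "finite ?A \<and> _")
proof (cases "3 \<le> m")
  case False
  then have A: "?A = {}" by (auto simp: is_cycle_def)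
  show ?thesis unfolding A by simp
next
  case True
  let ?B = "{xs. length xs = Suc (m - 2) \<and> hd xs = u \<and> successively (adj E) xs}"
  have sub: "butlast ` ?A \<subseteq> ?B"
  proof
    fix ys assume "ys \<in> butlast ` ?A"
    then obtain xs where xs: "ys = butlast xs" "length xs = m" "is_cycle (bip E) xs" "hd xs = u" by auto
    have "successively (adj E) xs"
      using xs by (auto simp: successively_conv_nth is_cycle_def adj_def)
        (metis Suc_lessD mod_less)
    moreover have "xs = ys @ [last xs]" using xs True by (metis append_butlast_last_id list.size(3) not_numeral_le_zero)
    ultimately have "successively (adj E) ys" by (metis successively_append_iff)
    then show "ys \<in> ?B" using xs True by (cases xs) auto
  qed
  have inj: "inj_on butlast ?A"
    using True by (intro inj_onI) (metis (mono_tags, lifting) append_butlast_last_id list.size(3) mem_Collect_eq not_numeral_le_zero)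
  have B: "finite ?B" "card ?B \<le> d ^ (m - 2)" using card_paths_le[OF assms] by auto
  show ?thesis
    using inj_on_finite[OF inj sub B(1)] card_inj_on_le[OF inj sub B(1)] B(2) by simp
qed

section \<open>Sparsified instances\<close>

lemma finite_edges: "wf_label_cover I \<Longrightarrow> finite (edges I)"
  unfolding wf_label_cover_def by (meson finite_SigmaI finite_lessThan finite_subset)

lemma regular_adj:
  assumes "wf_label_cover I" "regular I d"
  shows "finite {v. adj (edges I) u v} \<and> card {v. adj (edges I) u v} \<le> d"
proof -
  have E: "edges I \<subseteq> {..<nA I} \<times> {..<nB I}" using assms(1) by (simp add: wf_label_cover_def)
  show ?thesis
  proof (cases u)
    case (Inl a)
    have eq: "{v. adj (edges I) u v} = Inr ` {b. (a, b) \<in> edges I}"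
    proof (rule set_eqI)
      show "v \<in> {v. adj (edges I) u v} \<longleftrightarrow> v \<in> Inr ` {b. (a, b) \<in> edges I}" for v
        by (cases v) (auto simp: Inl)
    qed
    have fin: "finite {b. (a, b) \<in> edges I}"
      by (rule finite_subset[of _ "{..<nB I}"]) (use E in auto)
    have "card {b. (a, b) \<in> edges I} \<le> d"
    proof (cases "a < nA I")
      case False
      then have "{b. (a, b) \<in> edges I} = {}" using E by auto
      then show ?thesis by simp
    qed (use assms(2) in \<open>simp add: regular_def\<close>)
    then show ?thesis unfolding eq using fin by (simp add: card_image)
  next
    case (Inr b)
    have eq: "{v. adj (edges I) u v} = Inl ` {a. (a, b) \<in> edges I}"
    proof (rule set_eqI)
      show "v \<in> {v. adj (edges I) u v} \<longleftrightarrow> v \<in> Inl ` {a. (a, b) \<in> edges I}" for v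
        by (cases v) (auto simp: Inr)
    qed
    have fin: "finite {a. (a, b) \<in> edges I}"
      by (rule finite_subset[of _ "{..<nA I}"]) (use E in auto)
    have "card {a. (a, b) \<in> edges I} \<le> d"
    proof (cases "b < nB I")
      case False
      then have "{a. (a, b) \<in> edges I} = {}" using E by auto
      then show ?thesis by simp
    qed (use assms(2) in \<open>simp add: regular_def\<close>)
    then show ?thesis unfolding eq using fin by (simp add: card_image)
  qed
qed

lemma card_edges_regular:
  assumes "wf_label_cover I" "regular I d"
  shows "card (edges I) = nA I * d"
proof -
  have E: "edges I \<subseteq> {..<nA I} \<times> {..<nB I}" using assms(1) by (simp add: wf_label_cover_def)
  then have "edges I = (SIGMA a:{..<nA I}. {b. (a, b) \<in> edges I})" by auto
  moreover have "finite {b. (a, b) \<in> edges I}" for a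
    by (rule finite_subset[of _ "{..<nB I}"]) (use E in auto)
  then have "card (SIGMA a:{..<nA I}. {b. (a, b) \<in> edges I}) = (\<Sum>a<nA I. card {b. (a, b) \<in> edges I})"
    by (simp add: card_SigmaI)
  moreover have "\<dots> = nA I * d" using assms(2) by (simp add: regular_def)
  ultimately show ?thesis by metis
qed

text \<open>The cycles of length \<open>m\<close> contribute at most
  \<open>d ^ (m - 2) * p ^ m = p * (p * d) ^ (m - 1) / d\<close>. Since
  \<open>1 \<le> p * d\<close>, the largest length dominates.\<close>

lemma sum_cycles_le:
  fixes p :: real and E :: "('a \<times> 'b) set" and u v :: "'a + 'b"
  assumes deg: "\<And>u. finite {v. adj E u v} \<and> card {v. adj E u v} \<le> d"
    and p: "0 \<le> p" "1 \<le> p * real d" and "3 \<le> k"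
  defines "C \<equiv> {xs. is_cycle (bip E) xs \<and> hd xs = u \<and> last xs = v \<and> length xs \<le> k}"
  shows "finite C" "(\<Sum>xs\<in>C. p ^ card (cycle_edges xs)) \<le> real k * (p * (p * real d) ^ (k - 1) / real d)"
proof -
  define Cm where "Cm m = {xs. length xs = m \<and> is_cycle (bip E) xs \<and> hd xs = u \<and> last xs = v}" for m
  have Cm: "finite (Cm m)" "card (Cm m) \<le> d ^ (m - 2)" for m
    unfolding Cm_def using card_cycles_le[OF deg] by auto
  have C: "C = (\<Union>m\<in>{3..k}. Cm m)" by (auto simp: C_def Cm_def is_cycle_def)
  show "finite C" unfolding C using Cm by auto
  have d: "0 < d" using p by (cases d) auto
  have "(\<Sum>xs\<in>C. p ^ card (cycle_edges xs)) = (\<Sum>m\<in>{3..k}. \<Sum>xs\<in>Cm m. p ^ card (cycle_edges xs))"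
    unfolding C using Cm by (intro sum.UNION_disjoint) (auto simp: Cm_def)
  also have "\<dots> = (\<Sum>m\<in>{3..k}. \<Sum>xs\<in>Cm m. p ^ m)"
    by (intro sum.cong refl) (auto simp: Cm_def card_cycle_edges)
  also have "\<dots> \<le> (\<Sum>m\<in>{3..k}. p * (p * real d) ^ (k - 1) / real d)"
  proof (rule sum_mono)
    fix m assume m: "m \<in> {3..k}"
    define l where "l = m - 2"
    have l: "m = l + 2" using m by (auto simp: l_def)
    have "(\<Sum>xs\<in>Cm m. p ^ m) = real (card (Cm m)) * p ^ m" by simp
    also have "\<dots> \<le> real (d ^ (m - 2)) * p ^ m"
      using Cm(2)[of m] p by (intro mult_right_mono) (auto simp del: of_nat_power)
    also have "\<dots> = p * (p * real d) ^ (m - 1) / real d"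
      using d by (simp add: l power_mult_distrib field_simps)
    also have "\<dots> \<le> p * (p * real d) ^ (k - 1) / real d"
      using m p by (intro divide_right_mono mult_left_mono power_increasing) auto
    finally show "(\<Sum>xs\<in>Cm m. p ^ m) \<le> p * (p * real d) ^ (k - 1) / real d" .
  qed
  also have "\<dots> = real (k - 2) * (p * (p * real d) ^ (k - 1) / real d)" using assms(4) by simp
  also have "\<dots> \<le> real k * (p * (p * real d) ^ (k - 1) / real d)"
    using p by (intro mult_right_mono) auto
  finally show "(\<Sum>xs\<in>C. p ^ card (cycle_edges xs)) \<le> real k * (p * (p * real d) ^ (k - 1) / real d)" .
qed

text \<open>Which edges are removed depends on the order of insertion, but each of them closes a
  short cycle inside the sample. Counting edges on surviving cycles is free of the order and has a
  computable mean.\<close>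

lemma prob_many_removed:
  fixes p :: real
  assumes "distinct es" and deg: "\<And>u. finite {v. adj (set es) u v} \<and> card {v. adj (set es) u v} \<le> d"
    and p: "0 \<le> p" "p \<le> 1" "1 \<le> p * real d" and k: "3 \<le> k" "2 * h + 2 \<le> k" and "0 < \<tau>"
  shows "measure_pmf.prob (subs p es) {F. \<tau> \<le> real (card (set F - set (greedy h (rev F))))} \<le>
    real (length es) * (real k * (p * (p * real d) ^ (k - 1) / real d)) / \<tau>"
proof -
  define C where "C e = {xs. is_cycle (bip (set es)) xs \<and> hd xs = Inl (fst e) \<and> last xs = Inr (snd e) \<and> length xs \<le> k}"
    for e
  note C_le = sum_cycles_le[OF deg p(1,3) k(1), where u = "Inl (fst e)" and v = "Inr (snd e)" for e, folded C_def]
  let ?B = "{F. \<tau> \<le> real (card {e \<in> set es. \<exists>xs\<in>C e. cycle_edges xs \<subseteq> set F})}"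
  have "measure_pmf.prob (subs p es) {F. \<tau> \<le> real (card (set F - set (greedy h (rev F))))} =
      measure_pmf.prob (subs p es) ({F. \<tau> \<le> real (card (set F - set (greedy h (rev F))))} \<inter> set_pmf (subs p es))"
    by (simp add: measure_Int_set_pmf)
  also have "\<dots> \<le> measure_pmf.prob (subs p es) ?B"
  proof (intro measure_pmf.finite_measure_mono)
    show "{F. \<tau> \<le> real (card (set F - set (greedy h (rev F))))} \<inter> set_pmf (subs p es) \<subseteq> ?B"
    proof clarify
      fix F assume F: "F \<in> set_pmf (subs p es)" and le: "\<tau> \<le> real (card (set F - set (greedy h (rev F))))"
      have F': "set F \<subseteq> set es" "distinct F" using set_pmf_subs[OF F] assms(1) by auto
      have "set F - set (greedy h (rev F)) \<subseteq> {e \<in> set es. \<exists>xs\<in>C e. cycle_edges xs \<subseteq> set F}"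
      proof
        fix e assume e: "e \<in> set F - set (greedy h (rev F))"
        obtain a b where ab: "e = (a, b)" by force
        from greedy_removed[of "rev F" a b h] e F' obtain xs where
          xs: "is_cycle (bip (set F)) xs" "hd xs = Inl a" "last xs = Inr b" "length xs \<le> 2 * h + 2"
          by (auto simp: ab)
        then have "xs \<in> C e"
          using is_cycle_mono[OF xs(1) bip_mono[OF F'(1)]] k by (simp add: C_def ab)
        then show "e \<in> {e \<in> set es. \<exists>xs\<in>C e. cycle_edges xs \<subseteq> set F}"
          using cycle_edges_subset[OF xs(1)] e F' by auto
      qed
      then have "card (set F - set (greedy h (rev F))) \<le> card {e \<in> set es. \<exists>xs\<in>C e. cycle_edges xs \<subseteq> set F}"
        by (intro card_mono) auto
      with le show "\<tau> \<le> real (card {e \<in> set es. \<exists>xs\<in>C e. cycle_edges xs \<subseteq> set F})" by linarith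
    qed
  qed auto
  also have "\<dots> \<le> (\<Sum>e\<in>set es. \<Sum>xs\<in>C e. p ^ card (cycle_edges xs)) / \<tau>"
  proof (rule prob_many_covered_subs[OF assms(1) p(1,2) \<open>0 < \<tau>\<close>])
    show "finite (C e)" for e by (rule C_le)
    show "cycle_edges xs \<subseteq> set es" if "xs \<in> C e" for e xs
      using that by (intro cycle_edges_subset) (simp add: C_def)
  qed
  also have "\<dots> \<le> (\<Sum>e\<in>set es. real k * (p * (p * real d) ^ (k - 1) / real d)) / \<tau>"
    using \<open>0 < \<tau>\<close> by (intro divide_right_mono sum_mono C_le) auto
  also have "\<dots> = real (length es) * (real k * (p * (p * real d) ^ (k - 1) / real d)) / \<tau>"
    using assms(1) by (simp add: distinct_card)
  finally show ?thesis .
qed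

text \<open>A \<open>labeling\<close> is unconstrained outside the vertex ranges, so there are
  infinitely many. Their restrictions satisfy the same edges and form a finite family, over which a
  union bound is possible.\<close>

lemma satisfied_family:
  assumes "wf_label_cover I"
  obtains \<S> where "finite \<S>" "card \<S> \<le> qA I ^ num_vertices I"
    "\<And>f g. labeling I f g \<Longrightarrow> satisfied I f g \<in> \<S>"
    "\<And>S. S \<in> \<S> \<Longrightarrow> \<exists>f g. labeling I f g \<and> S = satisfied I f g"
proof
  let ?L = "PiE {..<nA I} (\<lambda>_. {..<qA I}) \<times> PiE {..<nB I} (\<lambda>_. {..<qB I})"
  let ?S = "(\<lambda>(f, g). satisfied I f g) ` ?L"
  have fin: "finite ?L" by (auto intro!: finite_PiE)
  then show "finite ?S" by simp
  have "card ?S \<le> card ?L" using fin by (rule card_image_le)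
  also have "\<dots> = qA I ^ nA I * qB I ^ nB I" by (simp add: card_cartesian_product card_PiE)
  also have "\<dots> \<le> qA I ^ nA I * qA I ^ nB I"
    using assms by (intro mult_left_mono power_mono) (auto simp: wf_label_cover_def)
  finally show "card ?S \<le> qA I ^ num_vertices I" by (simp add: num_vertices_def power_add)
  show "\<exists>f g. labeling I f g \<and> S = satisfied I f g" if S: "S \<in> ?S" for S
  proof -
    from S obtain f g where fg: "(f, g) \<in> ?L" "S = satisfied I f g" by auto
    then have "labeling I f g" by (auto simp: labeling_def dest: PiE_mem)
    with fg show ?thesis by blast
  qed
  show "satisfied I f g \<in> ?S" if "labeling I f g" for f g
  proof (rule image_eqI[of _ _ "(restrict f {..<nA I}, restrict g {..<nB I})"])
    have "edges I \<subseteq> {..<nA I} \<times> {..<nB I}" using assms by (simp add: wf_label_cover_def)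
    then show "satisfied I f g = (case (restrict f {..<nA I}, restrict g {..<nB I}) of (f, g) \<Rightarrow> satisfied I f g)"
      by (auto simp: satisfied_def)
    show "(restrict f {..<nA I}, restrict g {..<nB I}) \<in> ?L"
      using that by (auto simp: labeling_def)
  qed
qed

text \<open>The exponent is chosen so that \<open>p * 2 ^ (k * r) = 2 ^ r\<close>. As
  \<open>d\<close> lies within a factor \<open>2 ^ k\<close> of \<open>2 ^ (k * r)\<close>, rounding
  costs only \<open>(2 ^ k) ^ (k - 1)\<close>.\<close>

lemma keep_prob_bounds:
  fixes d k r :: nat
  assumes "0 < k" "2 ^ (k * r) \<le> d" "d < 2 ^ (k * Suc r)"
  defines "p \<equiv> (1/2 :: real) ^ ((k - 1) * r)"
  shows "0 < p" "p \<le> 1" "2 ^ r \<le> p * real d"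
    "(p * real d) ^ (k - 1) / real d \<le> (2 ^ k) ^ (k - 1) / 2 ^ r"
proof -
  show p: "0 < p" "p \<le> 1" by (auto simp: p_def power_le_one)
  have kr: "k * r = (k - 1) * r + r" using assms(1) by (cases k) auto
  have p2: "p * 2 ^ (k * r) = 2 ^ r"
    unfolding kr power_add p_def by (simp add: power_one_over)
  have d: "2 ^ (k * r) \<le> real d" "real d \<le> 2 ^ (k * Suc r)"
  proof -
    have "real (2 ^ (k * r)) \<le> real d" using assms(2) of_nat_le_iff by blast
    then show "2 ^ (k * r) \<le> real d" by simp
    have "real d \<le> real (2 ^ (k * Suc r))" using assms(3) by (intro of_nat_mono) simp
    then show "real d \<le> 2 ^ (k * Suc r)" by simp
  qed
  show lb: "2 ^ r \<le> p * real d"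
    using mult_left_mono[OF d(1), of p] p p2 by simp
  have "p * real d \<le> p * (2 ^ k * 2 ^ (k * r))"
    using mult_left_mono[OF d(2), of p] p by (simp add: power_add)
  also have "\<dots> = 2 ^ k * (p * 2 ^ (k * r))" by simp
  finally have ub: "p * real d \<le> 2 ^ k * 2 ^ r" by (simp only: p2)
  have "(p * real d) ^ (k - 1) / real d \<le> (2 ^ k * 2 ^ r) ^ (k - 1) / 2 ^ (k * r)"
    using ub lb p d by (intro frac_le power_mono) auto
  also have "\<dots> = (2 ^ k) ^ (k - 1) / 2 ^ r"
    unfolding kr power_add by (simp add: power_mult_distrib mult.commute flip: power_mult)
  finally show "(p * real d) ^ (k - 1) / real d \<le> (2 ^ k) ^ (k - 1) / 2 ^ r" .
qed

section \<open>The sparsified instance and its soundness\<close>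

definition sparsify :: "nat \<Rightarrow> label_cover \<Rightarrow> (nat \<times> nat) list \<Rightarrow> label_cover" where
  "sparsify k I F = I\<lparr>edges := set (greedy ((k - 2) div 2) (rev F))\<rparr>"

lemma sparsify_simps [simp]:
  "nA (sparsify k I F) = nA I" "nB (sparsify k I F) = nB I" "qA (sparsify k I F) = qA I"
  "qB (sparsify k I F) = qB I" "rel (sparsify k I F) = rel I"
  "edges (sparsify k I F) = set (greedy ((k - 2) div 2) (rev F))"
  "num_vertices (sparsify k I F) = num_vertices I"
  by (simp_all add: sparsify_def num_vertices_def)

lemma sparsify_girth_instances:
  assumes "wf_label_cover I" "set F \<subseteq> edges I" "F \<noteq> []" "3 \<le> k"
  shows "sparsify k I F \<in> girth_instances k"
proof -
  let ?h = "(k - 2) div 2"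
  have sub: "set (greedy ?h (rev F)) \<subseteq> edges I" using set_greedy[of ?h "rev F"] assms(2) by auto
  have "greedy ?h (rev F) \<noteq> []" using assms(3) by (simp add: greedy_eq_Nil_iff)
  then have "wf_label_cover (sparsify k I F)" using assms(1) sub by (auto simp: wf_label_cover_def)
  moreover have "enat (Suc k) \<le> lc_girth (sparsify k I F)"
    unfolding lc_girth_def girth_def sparsify_simps bip_def[symmetric]
  proof (rule INF_greatest)
    fix vs :: "(nat + nat) list" assume "vs \<in> {vs. is_cycle (bip (set (greedy ?h (rev F)))) vs}"
    then have "2 * ?h + 3 < length vs" using greedy_no_short_cycle by blast
    \<comment> \<open>For \<open>h = (k - 2) div 2\<close>, the number \<open>2 * h + 3\<close> is
      \<open>k + 1\<close> or \<open>k\<close>, according to the parity of \<open>k\<close>.\<close>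
    then have "Suc k \<le> length vs" using assms(4) by linarith
    then show "enat (Suc k) \<le> enat (length vs)" by simp
  qed
  then have "enat k < lc_girth (sparsify k I F)" by (metis eSuc_enat iless_Suc_eq order_less_le_trans order_refl)
  ultimately show ?thesis by (simp add: girth_instances_def)
qed

lemma sparsify_all_satisfiable:
  assumes "all_satisfiable I" "set F \<subseteq> edges I"
  shows "all_satisfiable (sparsify k I F)"
proof -
  let ?G = "set (greedy ((k - 2) div 2) (rev F))"
  have sub: "?G \<subseteq> edges I" using set_greedy[of _ "rev F"] assms(2) by fastforce
  obtain f g where "labeling I f g" "satisfied I f g = edges I"
    using assms(1) by (auto simp: all_satisfiable_def)
  then have "labeling (sparsify k I F) f g" "satisfied (sparsify k I F) f g = ?G"
    using sub by (auto simp: labeling_def satisfied_def)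
  then show ?thesis unfolding all_satisfiable_def by auto
qed

text \<open>\<open>Np\<close> is the expected sample size. Outside three bad events at least
  \<open>Np / 4\<close> edges are sampled, fewer than \<open>Np / 8\<close> are dropped again, and
  every labeling satisfies at most \<open>8 * Np / \<alpha>\<close> of the sampled edges. The
  quotient of \<open>8 * Np / \<alpha>\<close> and \<open>Np / 8\<close> is
  \<open>64 / \<alpha>\<close>.\<close>

lemma prob_sparsify_unsound:
  fixes \<alpha> s :: real
  assumes I: "wf_label_cover I" "nA I = nB I" "regular I d" "at_most_satisfiable I s"
    and es: "distinct es" "set es = edges I"
    and k: "3 \<le> k" and r: "2 ^ (k * r) \<le> d" "d < 2 ^ (k * Suc r)"
    and \<alpha>: "0 < \<alpha>" "s \<le> 1 / \<alpha>" "2 \<le> qA I" "\<alpha> * log 2 (real (qA I)) \<le> 2 * 2 ^ r"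
  defines "n \<equiv> real (num_vertices I)" and "p \<equiv> (1/2 :: real) ^ ((k - 1) * r)"
  shows "measure_pmf.prob (subs p es) {F. F = [] \<or> \<not> at_most_satisfiable (sparsify k I F) (64 / \<alpha>)} \<le>
    exp (- (n / 8)) + 2 powr (- (n / 2)) + 8 * real k * (2 ^ k) ^ (k - 1) / 2 ^ r"
proof -
  define h where "h = (k - 2) div 2"
  have h: "2 * h + 2 \<le> k" using k by (auto simp: h_def)
  define Np where "Np = real (length es) * p"
  note pd = keep_prob_bounds[OF _ r, folded p_def]
  have p: "0 < p" "p \<le> 1" "2 ^ r \<le> p * real d" "(p * real d) ^ (k - 1) / real d \<le> (2 ^ k) ^ (k - 1) / 2 ^ r"
    using pd k by auto
  have "edges I \<noteq> {}" using I(1) by (simp add: wf_label_cover_def)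
  then have "0 < nA I" using I(1) by (auto simp: wf_label_cover_def)
  then have n: "0 < n" "n = 2 * real (nA I)" using I(2) by (auto simp: n_def num_vertices_def)
  have len: "length es = nA I * d"
    using card_edges_regular[OF I(1,3)] es by (metis distinct_card)
  have Np_eq: "Np = n / 2 * (p * real d)" by (simp add: Np_def len n)
  have one: "1 \<le> p * real d" using p(3) order.trans[OF one_le_power[of "2::real" r]] by simp
  have Np_n: "n / 2 \<le> Np" unfolding Np_eq using mult_left_mono[OF one, of "n / 2"] n by simp
  have Np: "0 < Np" using Np_n n by linarith
  define M where "M = Np / \<alpha>"
  define lq where "lq = log 2 (real (qA I))"
  have lq: "1 \<le> lq" using \<alpha>(3) by (simp add: lq_def le_log_iff)
  \<comment> \<open>The union bound is over at most \<open>2 powr (n * lq)\<close> sets; this puts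
    its exponent on the scale of \<open>M\<close>, which bounds the expected number of satisfied
    sampled edges for each labeling.\<close>
  have M: "n * lq \<le> 4 * M"
  proof -
    have "\<alpha> * lq \<le> 2 * (p * real d)" using \<alpha>(4) p(3) by (simp add: lq_def)
    then have "n * (\<alpha> * lq) \<le> n * (2 * (p * real d))" using n by (intro mult_left_mono) auto
    then show ?thesis using \<alpha>(1) by (simp add: M_def Np_eq field_simps)
  qed
  obtain \<S> where S: "finite \<S>" "card \<S> \<le> qA I ^ num_vertices I"
    "\<And>f g. labeling I f g \<Longrightarrow> satisfied I f g \<in> \<S>"
    "\<And>S. S \<in> \<S> \<Longrightarrow> \<exists>f g. labeling I f g \<and> S = satisfied I f g"
    using satisfied_family[OF I(1)] by blast

  let ?few = "{F. real (card (set F)) < real (length es) * p / 4}"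
  let ?rem = "{F. Np / 8 \<le> real (card (set F - set (greedy h (rev F))))}"
  let ?sat = "{F. \<exists>S\<in>\<S>. 8 * M < real (card (S \<inter> set F))}"
  let ?bad = "{F. F = [] \<or> \<not> at_most_satisfiable (sparsify k I F) (64 / \<alpha>)}"
  let ?P = "measure_pmf.prob (subs p es)"

  have few: "?P ?few \<le> exp (- (n / 8))"
  proof -
    have "?P ?few \<le> exp (- (real (length es) * p / 4))"
      using p es by (intro prob_few_subs) auto
    also have "\<dots> \<le> exp (- (n / 8))" using Np_n by (simp add: Np_def)
    finally show ?thesis .
  qed
  have rem: "?P ?rem \<le> 8 * real k * (2 ^ k) ^ (k - 1) / 2 ^ r"
  proof -
    have "?P ?rem \<le> real (length es) * (real k * (p * (p * real d) ^ (k - 1) / real d)) / (Np / 8)"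
      using p one k h Np es regular_adj[OF I(1,3)] by (intro prob_many_removed) auto
    also have "\<dots> = 8 * real k * ((p * real d) ^ (k - 1) / real d)"
    proof -
      have "L * (K * (p * X)) / (L * p / 8) = 8 * K * X" if "L \<noteq> 0" for L K X :: real
        using that p(1) by (simp add: field_simps)
      moreover have "real (length es) \<noteq> 0" using Np by (auto simp: Np_def)
      ultimately have "real (length es) * (real k * (p * ((p * real d) ^ (k - 1) / real d))) /
          (real (length es) * p / 8) = 8 * real k * ((p * real d) ^ (k - 1) / real d)"
        by blast
      then show ?thesis by (simp only: Np_def times_divide_eq_right)
    qed
    also have "\<dots> \<le> 8 * real k * ((2 ^ k) ^ (k - 1) / 2 ^ r)"
      using p(4) by (intro mult_left_mono) auto
    finally show ?thesis by simp
  qed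
  have sat: "?P ?sat \<le> 2 powr (- (n / 2))"
  proof -
    have S': "S \<subseteq> set es \<and> real (card S) \<le> real (length es) / \<alpha>" if "S \<in> \<S>" for S
    proof -
      obtain f g where fg: "labeling I f g" "S = satisfied I f g" using S(4) \<open>S \<in> \<S>\<close> by blast
      have pos: "0 < real (card (edges I))" using \<open>edges I \<noteq> {}\<close> finite_edges[OF I(1)] by (simp add: card_gt_0_iff)
      have "real (card S) / real (card (edges I)) \<le> 1 / \<alpha>"
        using I(4) fg \<alpha>(2) unfolding at_most_satisfiable_def by (meson order.trans)
      then have "real (card S) \<le> real (card (edges I)) / \<alpha>" using pos by (simp add: field_simps)
      moreover have "card (edges I) = length es" using es by (metis distinct_card)
      ultimately show ?thesis using fg(2) es(2) by (auto simp: satisfied_def)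
    qed
    have "?P ?sat \<le> real (card \<S>) * (exp (p * (real (length es) / \<alpha>)) / 2 powr (8 * M))"
      using p es(1) S(1) S' by (intro prob_many_subs_union) auto
    also have "p * (real (length es) / \<alpha>) = M" by (simp add: M_def Np_def)
    \<comment> \<open>The threshold \<open>8 * M\<close> leaves room for \<open>4 * M\<close> from
      the union bound and \<open>2 * M\<close> from \<open>exp M \<le> 2 powr (2 * M)\<close>. What
      remains is \<open>- 2 * M\<close>, and \<open>n \<le> 4 * M\<close> because \<open>lq\<close>
      is at least 1.\<close>
    also have "real (card \<S>) * (exp M / 2 powr (8 * M)) \<le> 2 powr (4 * M) * (2 powr (2 * M) / 2 powr (8 * M))"
    proof (intro mult_mono divide_right_mono)
      have "real (card \<S>) \<le> real (qA I ^ num_vertices I)" using S(2) by (rule of_nat_mono)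
      also have "\<dots> = real (qA I) powr n" using \<alpha>(3) by (simp add: n_def powr_realpow)
      also have "\<dots> = (2 powr lq) powr n" using \<alpha>(3) by (simp add: lq_def)
      also have "\<dots> = 2 powr (n * lq)" by (simp add: powr_powr mult.commute)
      also have "\<dots> \<le> 2 powr (4 * M)" using M by simp
      finally show "real (card \<S>) \<le> 2 powr (4 * M)" .
      have "0 \<le> M" using Np \<alpha>(1) by (simp add: M_def)
      moreover have "exp (1/2 :: real) \<le> 2" by (rule exp_half_le2)
      then have "1/2 \<le> ln (2::real)" by (subst ln_ge_iff) simp_all
      ultimately have "M * (1/2) \<le> M * ln 2" by (intro mult_left_mono) auto
      then show "exp M \<le> 2 powr (2 * M)" by (simp add: powr_def)
    qed auto
    also have "\<dots> = 2 powr (- (2 * M))" by (simp flip: powr_add powr_diff)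
    also have "\<dots> \<le> 2 powr (- (n / 2))"
    proof -
      have "n * 1 \<le> n * lq" using n lq by (intro mult_left_mono) auto
      then show ?thesis using M by simp
    qed
    finally show ?thesis .
  qed

  have "?bad \<inter> set_pmf (subs p es) \<subseteq> ?few \<union> ?sat \<union> ?rem"
  proof (rule subsetI, rule ccontr)
    fix F assume F: "F \<in> ?bad \<inter> set_pmf (subs p es)" and "F \<notin> ?few \<union> ?sat \<union> ?rem"
    then have nfew: "Np / 4 \<le> real (card (set F))"
      and nrem: "real (card (set F - set (greedy h (rev F)))) < Np / 8"
      and nsat: "\<And>S. S \<in> \<S> \<Longrightarrow> real (card (S \<inter> set F)) \<le> 8 * M"
      by (auto simp: Np_def not_less not_le)
    let ?G = "set (greedy h (rev F))"
    have G: "?G \<subseteq> set F" using set_greedy[of h "rev F"] by simp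
    have FE: "set F \<subseteq> edges I" using F set_pmf_subs(1)[of F p es] es by auto
    have "card (set F) = card ?G + card (set F - ?G)"
      using card_Diff_subset[OF _ G] card_mono[OF _ G] by simp
    then have cG: "Np / 8 \<le> real (card ?G)" using nfew nrem by linarith
    have "at_most_satisfiable (sparsify k I F) (64 / \<alpha>)"
      unfolding at_most_satisfiable_def
    proof (intro allI impI)
      fix f g assume "labeling (sparsify k I F) f g"
      then have lab: "labeling I f g" by (simp add: labeling_def)
      have "satisfied (sparsify k I F) f g \<subseteq> satisfied I f g \<inter> set F"
        using G FE by (auto simp: satisfied_def h_def)
      then have "real (card (satisfied (sparsify k I F) f g)) \<le> real (card (satisfied I f g \<inter> set F))"
        by (intro of_nat_mono card_mono) auto
      also have "\<dots> \<le> 8 * M" using nsat[OF S(3)[OF lab]] .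
      also have "8 * M = 64 / \<alpha> * (Np / 8)" by (simp add: M_def)
      also have "\<dots> \<le> 64 / \<alpha> * real (card ?G)" using cG \<alpha>(1) by (intro mult_left_mono) auto
      finally show "real (card (satisfied (sparsify k I F) f g)) / real (card (edges (sparsify k I F))) \<le> 64 / \<alpha>"
        using cG Np by (simp add: h_def divide_le_eq)
    qed
    moreover have "F \<noteq> []" using nfew Np by auto
    ultimately show False using F by simp
  qed
  then have "?P (?bad \<inter> set_pmf (subs p es)) \<le> ?P (?few \<union> ?sat \<union> ?rem)"
    by (intro measure_pmf.finite_measure_mono) auto
  also have "\<dots> \<le> ?P ?few + ?P ?sat + ?P ?rem"
    using measure_Un_le[of ?few "measure_pmf (subs p es)" ?sat]
      measure_Un_le[of "?few \<union> ?sat" "measure_pmf (subs p es)" ?rem] by simp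
  finally have "?P ?bad \<le> ?P ?few + ?P ?sat + ?P ?rem" by (simp only: measure_Int_set_pmf)
  then show ?thesis using few rem sat by linarith
qed

section \<open>Correctness of the reduction\<close>

lemma accept_prob_bounds: "0 \<le> accept_prob P T x" "accept_prob P T x \<le> 1"
  by (simp_all add: accept_prob_def)

lemma expectation_subs_bounds:
  fixes f :: "'a list \<Rightarrow> real"
  assumes "\<And>F. 0 \<le> f F" "\<And>F. f F \<le> 1" "0 \<le> c" "c \<le> 1"
    and "measure_pmf.prob (subs p es) B \<le> \<delta>"
  shows "(\<And>F. F \<in> set_pmf (subs p es) \<Longrightarrow> F \<notin> B \<Longrightarrow> f F \<le> c) \<Longrightarrow>
      measure_pmf.expectation (subs p es) f \<le> c + \<delta>"
    and "(\<And>F. F \<in> set_pmf (subs p es) \<Longrightarrow> F \<notin> B \<Longrightarrow> c \<le> f F) \<Longrightarrow>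
      c - \<delta> \<le> measure_pmf.expectation (subs p es) f"
proof -
  assume *: "\<And>F. F \<in> set_pmf (subs p es) \<Longrightarrow> F \<notin> B \<Longrightarrow> f F \<le> c"
  have "measure_pmf.expectation (subs p es) f \<le> measure_pmf.expectation (subs p es) (\<lambda>F. c + indicator B F)"
    using * assms(2,3) by (intro integral_mono_AE AE_pmfI) (auto simp: indicator_def intro: add_increasing)
  also have "\<dots> = c + measure_pmf.prob (subs p es) B" by simp
  finally show "measure_pmf.expectation (subs p es) f \<le> c + \<delta>" using assms(5) by linarith
next
  assume *: "\<And>F. F \<in> set_pmf (subs p es) \<Longrightarrow> F \<notin> B \<Longrightarrow> c \<le> f F"
  have "c - 1 \<le> f F" for F using assms(1)[of F] assms(4) by linarith
  then have "measure_pmf.expectation (subs p es) (\<lambda>F. c - indicator B F) \<le> measure_pmf.expectation (subs p es) f"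
    using * by (intro integral_mono_AE AE_pmfI) (auto simp: indicator_def)
  moreover have "measure_pmf.expectation (subs p es) (\<lambda>F. c - indicator B F) = c - measure_pmf.prob (subs p es) B"
    by simp
  ultimately show "c - \<delta> \<le> measure_pmf.expectation (subs p es) f" using assms(5) by linarith
qed

lemma encodes_obtain:
  assumes "encodes x I"
  obtains es rs where "distinct es" "set es = edges I"
    "\<And>e. e \<in> edges I \<Longrightarrow> distinct (rs e) \<and> set (rs e) = rel I e"
    "x = Node (enc_nat (nA I)) (Node (enc_nat (nB I)) (Node (enc_nat (qA I)) (Node (enc_nat (qB I))
       (enc_list (enc_edge rs) es))))"
  using assms unfolding encodes_def enc_edge_def[abs_def] by blast

definition enc_sparsify ::
  "nat \<Rightarrow> label_cover \<Rightarrow> (nat \<times> nat \<Rightarrow> (nat \<times> nat) list) \<Rightarrow> (nat \<times> nat) list \<Rightarrow> data" where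
  "enc_sparsify k I rs F = Node (enc_nat (nA I)) (Node (enc_nat (nB I)) (Node (enc_nat (qA I))
     (Node (enc_nat (qB I)) (enc_list (enc_edge rs) (greedy ((k - 2) div 2) (rev F))))))"

text \<open>A distinguisher must work on every encoding, so the order in which the program happens
  to list the edges is harmless.\<close>

lemma encodes_enc_sparsify:
  assumes "set F \<subseteq> edges I" "distinct F"
    and "\<And>e. e \<in> edges I \<Longrightarrow> distinct (rs e) \<and> set (rs e) = rel I e"
  shows "encodes (enc_sparsify k I rs F) (sparsify k I F)"
  unfolding encodes_def
proof (intro exI conjI ballI)
  let ?G = "greedy ((k - 2) div 2) (rev F)"
  show "distinct ?G" using assms(2) by (simp add: distinct_greedy)
  show "set ?G = edges (sparsify k I F)" by simp
  fix e assume "e \<in> edges (sparsify k I F)"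
  then have "e \<in> edges I" using set_greedy[of _ "rev F"] assms(1) by fastforce
  then show "distinct (rs e)" "set (rs e) = rel (sparsify k I F) e" using assms(3) by auto
qed (simp add: enc_sparsify_def enc_edge_def[abs_def])

lemma accept_prob_sparsify:
  assumes acc: "\<And>x. accept_prob P (poly p) x =
      measure_pmf.expectation (flips (length (dlist (dnbits k x))))
        (\<lambda>bs. accept_prob Q (poly q) (dsparsify k (Node x (enc_list enc_bool bs))))"
    and I: "wf_label_cover I" "regular I d" and "0 < d" "0 < k"
    and es: "distinct es" "set es = edges I"
    and x: "x = Node (enc_nat (nA I)) (Node (enc_nat (nB I)) (Node (enc_nat (qA I)) (Node (enc_nat (qB I))
       (enc_list (enc_edge rs) es))))"
  obtains r where "2 ^ (k * r) \<le> d" "d < 2 ^ (k * Suc r)"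
    "accept_prob P (poly p) x = measure_pmf.expectation (subs ((1/2) ^ ((k - 1) * r)) es)
       (\<lambda>F. accept_prob Q (poly q) (enc_sparsify k I rs F))"
proof -
  obtain r where r: "dexp k (enc_nat d) = enc_nat ((k - 1) * r)" "2 ^ (k * r) \<le> d" "d < 2 ^ (k * Suc r)"
    using dexp_enc_nat[OF assms(4,5)] by blast
  let ?j = "(k - 1) * r"
  have "edges I \<noteq> {}" "edges I \<subseteq> {..<nA I} \<times> {..<nB I}" using I(1) by (simp_all add: wf_label_cover_def)
  \<comment> \<open>Vertex 0 is a genuine vertex, so counting its edges yields the degree.\<close>
  then have "0 < nA I" by auto
  then have "card {b. (0, b) \<in> edges I} = d" using I(2) by (simp add: regular_def)
  moreover have "length (filter (\<lambda>e. fst e = 0) es) = card (set (filter (\<lambda>e. fst e = 0) es))"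
    using es(1) by (metis distinct_card distinct_filter)
  moreover have "set (filter (\<lambda>e. fst e = 0) es) = Pair 0 ` {b. (0, b) \<in> edges I}"
    using es(2) by (auto simp: image_iff)
  ultimately have "length (filter (\<lambda>e. fst e = 0) es) = d"
    by (simp add: card_image inj_on_def)
  then have j: "dexp k (ddegree (dedges x)) = enc_nat ?j"
    by (simp add: x dedges_def ddegree_enc_list r(1))
  have n: "length (dlist (dnbits k x)) = length es * ?j"
    unfolding dnbits_def j length_dmul by (simp add: x dedges_def)
  have out: "dsparsify k (Node x (enc_list enc_bool bs)) = enc_sparsify k I rs (sel ?j bs es)" for bs
    unfolding dsparsify_def data_fst.simps data_snd.simps j
    by (simp add: x dedges_def dsel_enc_list dgreedy_enc_list enc_sparsify_def)
  have "accept_prob P (poly p) x = measure_pmf.expectation (map_pmf (\<lambda>bs. sel ?j bs es) (flips (length es * ?j)))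
       (\<lambda>F. accept_prob Q (poly q) (enc_sparsify k I rs F))"
    unfolding acc n out by simp
  then show ?thesis using that r unfolding map_sel_flips by blast
qed

text \<open>Division by zero gives 0, and so do \<open>log 2 0\<close>, \<open>log 2 1\<close> and
  \<open>0 powr x\<close>. In each degenerate case one upper bound on \<alpha> would be 0, so
  positivity of \<alpha> already enforces \<open>0 < d\<close>, \<open>2 \<le> q\<close> and a
  positive \<open>s\<close>. The factor 2 in \<open>2 * 2 ^ r\<close> comes from rounding
  \<open>d powr (1 / k)\<close> and turns 18 into 9.\<close>

lemma parameter_bounds:
  fixes \<alpha> s :: real
  assumes "2 \<le> n" "0 < k" "18 * log 2 (real n) \<le> \<alpha>"
    and "\<alpha> \<le> min (1 / s) (real d powr (1 / real k) / log 2 (real q))"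
  shows "0 < \<alpha>" "0 < d" "2 \<le> q" "s \<le> 1 / \<alpha>"
    "d < 2 ^ (k * Suc r) \<Longrightarrow> \<alpha> * log 2 (real q) \<le> 2 * 2 ^ r"
    "d < 2 ^ (k * Suc r) \<Longrightarrow> 9 * log 2 (real n) \<le> 2 ^ r"
proof -
  have "1 \<le> log 2 (real n)" using assms(1) by (simp add: le_log_iff)
  then show \<alpha>: "0 < \<alpha>" using assms(3) by linarith
  have "0 < real d powr (1 / real k) / log 2 (real q)" using \<alpha> assms(4) by linarith
  then have pos: "0 < real d powr (1 / real k)" and lq: "0 < log 2 (real q)"
    using powr_ge_zero[of "real d" "1 / real k"] by (auto simp: zero_less_divide_iff)
  show d: "0 < d" using pos by (cases d) auto
  show q: "2 \<le> q"
  proof (rule ccontr)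
    assume "\<not> 2 \<le> q"
    then have "q = 0 \<or> q = 1" by auto
    then show False using lq by (auto simp: log_def)
  qed
  have "0 < 1 / s" "\<alpha> \<le> 1 / s" using \<alpha> assms(4) by linarith+
  then show "s \<le> 1 / \<alpha>" using \<alpha> by (auto simp: field_simps zero_less_divide_iff)
  have le: "\<alpha> * log 2 (real q) \<le> real d powr (1 / real k)"
    using assms(4) lq by (simp add: pos_le_divide_eq)
  assume "d < 2 ^ (k * Suc r)"
  then have "real d \<le> real (2 ^ (k * Suc r))" by (intro of_nat_mono) simp
  then have "real d \<le> 2 powr (real k * real (Suc r))" by (simp add: algebra_simps flip: powr_realpow)
  then have "real d powr (1 / real k) \<le> (2 powr (real k * real (Suc r))) powr (1 / real k)"
    by (intro powr_mono2) auto
  also have "\<dots> = 2 powr real (Suc r)" using assms(2) by (simp add: powr_powr)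
  also have "\<dots> = 2 * 2 ^ r" using powr_realpow[of 2 "Suc r"] by simp
  finally show *: "\<alpha> * log 2 (real q) \<le> 2 * 2 ^ r" using le by linarith
  have "1 \<le> log 2 (real q)" using q by (simp add: le_log_iff)
  then have "\<alpha> * 1 \<le> \<alpha> * log 2 (real q)" using \<alpha> by (intro mult_left_mono) auto
  then show "9 * log 2 (real n) \<le> 2 ^ r" using * assms(3) by linarith
qed

theorem theorem4:
  fixes k :: nat and d q :: "nat \<Rightarrow> nat" and s :: "nat \<Rightarrow> real"
  assumes "3 \<le> k"
    and "\<not> rand_polytime_distinguishable
           {I \<in> regular_instances d q. all_satisfiable I}
           {I \<in> regular_instances d q. at_most_satisfiable I (s (num_vertices I))}"
  shows "\<exists>c::real. 0 < c \<and>
    (\<forall>\<alpha> :: nat \<Rightarrow> real.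
       (\<forall>\<^sub>F n in sequentially.
          18 * log 2 (real n) \<le> \<alpha> n \<and>
          \<alpha> n \<le> min (1 / s n) (real (d n) powr (1 / real k) / log 2 (real (q n)))) \<longrightarrow>
       \<not> rand_polytime_distinguishable
           {I \<in> girth_instances k. all_satisfiable I}
           {I \<in> girth_instances k. at_most_satisfiable I (c / \<alpha> (num_vertices I))})"
proof (intro exI[of _ 64] conjI allI impI notI)
  fix \<alpha> :: "nat \<Rightarrow> real"
  assume \<alpha>: "\<forall>\<^sub>F n in sequentially.
      18 * log 2 (real n) \<le> \<alpha> n \<and>
      \<alpha> n \<le> min (1 / s n) (real (d n) powr (1 / real k) / log 2 (real (q n)))"
    and "rand_polytime_distinguishable {I \<in> girth_instances k. all_satisfiable I}
      {I \<in> girth_instances k. at_most_satisfiable I (64 / \<alpha> (num_vertices I))}"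
  then obtain Q u \<epsilon>0 n0 where \<epsilon>0: "0 < \<epsilon>0" and time: "runs_in_time Q (poly u)"
    and Q: "\<And>I x. encodes x I \<Longrightarrow> n0 \<le> num_vertices I \<Longrightarrow> I \<in> girth_instances k \<Longrightarrow>
         (all_satisfiable I \<longrightarrow> 1/2 + \<epsilon>0 \<le> accept_prob Q (poly u) x) \<and>
         (at_most_satisfiable I (64 / \<alpha> (num_vertices I)) \<longrightarrow> accept_prob Q (poly u) x \<le> 1/2 - \<epsilon>0)"
    unfolding rand_polytime_distinguishable_def by blast
  \<comment> \<open>The cap keeps \<open>1/2 + \<epsilon>\<close> and
    \<open>1/2 - \<epsilon>\<close> within the range of probabilities, as
    \<open>expectation_subs_bounds\<close> demands.\<close>
  define \<epsilon> where "\<epsilon> = min \<epsilon>0 (1/2)"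
  have \<epsilon>: "0 < \<epsilon>" "\<epsilon> \<le> 1/2" "\<epsilon> \<le> \<epsilon>0" using \<epsilon>0 by (auto simp: \<epsilon>_def)
  define K where "K = 8 * real k * (2 ^ k) ^ (k - 1)"
  have K: "0 \<le> K" by (simp add: K_def)
  \<comment> \<open>With \<open>2 ^ r\<close> replaced by its lower bound
    \<open>9 * log 2 n\<close>, the error is a function of \<open>n\<close> alone and tends to 0;
    half of the advantage \<epsilon> then survives.\<close>
  define \<delta> where "\<delta> n = exp (- (real n / 8)) + 2 powr (- (real n / 2)) + K / (9 * log 2 (real n))" for n :: nat
  have "(\<lambda>n. exp (- (real n / 8))) \<longlonglongrightarrow> 0" "(\<lambda>n. 2 powr (- (real n / 2))) \<longlonglongrightarrow> 0"
      "(\<lambda>n. 1 / (9 * log 2 (real n))) \<longlonglongrightarrow> 0"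
    by real_asymp+
  from tendsto_add[OF tendsto_add[OF this(1,2)] tendsto_mult_right_zero[OF this(3), of K]]
  have "\<delta> \<longlonglongrightarrow> 0 + 0 + 0" unfolding \<delta>_def by simp
  then have "\<delta> \<longlonglongrightarrow> 0" by simp
  then have "\<forall>\<^sub>F n in sequentially. \<delta> n < \<epsilon> / 2" using \<epsilon> by (intro order_tendstoD) auto
  with \<alpha> have "\<forall>\<^sub>F n in sequentially. (18 * log 2 (real n) \<le> \<alpha> n \<and>
      \<alpha> n \<le> min (1 / s n) (real (d n) powr (1 / real k) / log 2 (real (q n)))) \<and> \<delta> n < \<epsilon> / 2 \<and> max 2 n0 \<le> n"
    using eventually_ge_at_top[of "max 2 n0"] by eventually_elim blast
  then obtain n1 where n1: "\<And>n. n1 \<le> n \<Longrightarrow> 18 * log 2 (real n) \<le> \<alpha> n"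
      "\<And>n. n1 \<le> n \<Longrightarrow> \<alpha> n \<le> min (1 / s n) (real (d n) powr (1 / real k) / log 2 (real (q n)))"
      "\<And>n. n1 \<le> n \<Longrightarrow> \<delta> n < \<epsilon> / 2" "\<And>n. n1 \<le> n \<Longrightarrow> 2 \<le> n" "\<And>n. n1 \<le> n \<Longrightarrow> n0 \<le> n"
    unfolding eventually_sequentially by (metis max.bounded_iff)
  obtain P p where P: "runs_in_time P (poly p)"
    and acc: "\<And>x. accept_prob P (poly p) x =
      measure_pmf.expectation (flips (length (dlist (dnbits k x))))
        (\<lambda>bs. accept_prob Q (poly u) (dsparsify k (Node x (enc_list enc_bool bs))))"
    using randomized_reduction[OF ptime_dnbits ptime_dsparsify time] by metis

  have main: "(all_satisfiable I \<longrightarrow> 1/2 + \<epsilon> / 2 \<le> accept_prob P (poly p) x) \<and>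
      (at_most_satisfiable I (s (num_vertices I)) \<longrightarrow> accept_prob P (poly p) x \<le> 1/2 - \<epsilon> / 2)"
    if x: "encodes x I" and n: "n1 \<le> num_vertices I" and I: "I \<in> regular_instances d q" for I x
  proof -
    let ?n = "num_vertices I"
    have I': "wf_label_cover I" "nA I = nB I" "regular I (d ?n)" "qA I = q ?n"
      using I by (auto simp: regular_instances_def)
    have k: "0 < k" using assms(1) by simp
    note pb = parameter_bounds[OF n1(4)[OF n] k n1(1)[OF n] n1(2)[OF n]]
    obtain es rs where es: "distinct es" "set es = edges I"
      and rs: "\<And>e. e \<in> edges I \<Longrightarrow> distinct (rs e) \<and> set (rs e) = rel I e"
      and x_eq: "x = Node (enc_nat (nA I)) (Node (enc_nat (nB I)) (Node (enc_nat (qA I)) (Node (enc_nat (qB I))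
         (enc_list (enc_edge rs) es))))"
      using encodes_obtain[OF x] by metis
    obtain r where r: "2 ^ (k * r) \<le> d ?n" "d ?n < 2 ^ (k * Suc r)"
      and acc_x: "accept_prob P (poly p) x = measure_pmf.expectation (subs ((1/2) ^ ((k - 1) * r)) es)
         (\<lambda>F. accept_prob Q (poly u) (enc_sparsify k I rs F))"
      using accept_prob_sparsify[OF acc I'(1,3) pb(2) k es x_eq] by metis
    let ?S = "subs ((1/2) ^ ((k - 1) * r)) es"
    have "0 < 9 * log 2 (real ?n)" using n1(4)[OF n] by simp
    then have "K / 2 ^ r \<le> K / (9 * log 2 (real ?n))"
      using pb(6)[OF r(2)] K by (intro divide_left_mono) auto
    then have \<delta>: "exp (- (real ?n / 8)) + 2 powr (- (real ?n / 2)) + K / 2 ^ r \<le> \<epsilon> / 2"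
      using n1(3)[OF n] unfolding \<delta>_def by linarith
    have good: "(all_satisfiable I \<longrightarrow> 1/2 + \<epsilon> \<le> accept_prob Q (poly u) (enc_sparsify k I rs F)) \<and>
        (at_most_satisfiable (sparsify k I F) (64 / \<alpha> ?n) \<longrightarrow>
          accept_prob Q (poly u) (enc_sparsify k I rs F) \<le> 1/2 - \<epsilon>)"
      if F: "F \<in> set_pmf ?S" "F \<noteq> []" for F
    proof -
      have F': "set F \<subseteq> edges I" "distinct F" using set_pmf_subs[OF F(1)] es by auto
      have "encodes (enc_sparsify k I rs F) (sparsify k I F)"
        using F' rs by (rule encodes_enc_sparsify)
      moreover have "sparsify k I F \<in> girth_instances k"
        by (rule sparsify_girth_instances[OF I'(1) F'(1) F(2) assms(1)])
      ultimately show ?thesis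
        using Q[of "enc_sparsify k I rs F" "sparsify k I F"] n1(5)[OF n] \<epsilon>(3)
          sparsify_all_satisfiable[OF _ F'(1), of k] by fastforce
    qed
    show ?thesis
    proof (intro conjI impI)
      \<comment> \<open>Only the empty sample can do harm here, and it falls short of a quarter of
        the expected sample size.\<close>
      assume sat: "all_satisfiable I"
      let ?p = "(1/2 :: real) ^ ((k - 1) * r)"
      have pd: "0 < ?p" "?p \<le> 1" "2 ^ r \<le> ?p * real (d ?n)"
        using keep_prob_bounds[OF k r] by auto
      have len: "length es = nA I * d ?n"
        using card_edges_regular[OF I'(1,3)] es by (metis distinct_card)
      have nn: "real ?n = 2 * real (nA I)" using I'(2) by (simp add: num_vertices_def)
      have "1 \<le> ?p * real (d ?n)" using pd(3) order.trans[OF one_le_power[of "2::real" r]] by simp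
      then have "real (nA I) * 1 \<le> real (nA I) * (?p * real (d ?n))" by (intro mult_left_mono) auto
      then have Np: "real ?n / 8 \<le> real (length es) * ?p / 4" by (simp add: len nn algebra_simps)
      have "measure_pmf.prob ?S {[]} \<le> measure_pmf.prob ?S {F. real (card (set F)) < real (length es) * ?p / 4}"
        using Np n1(4)[OF n] by (intro measure_pmf.finite_measure_mono) auto
      also have "\<dots> \<le> exp (- (real (length es) * ?p / 4))"
        using pd es by (intro prob_few_subs) auto
      also have "\<dots> \<le> exp (- (real ?n / 8))" using Np by simp
      also have "\<dots> \<le> \<epsilon> / 2"
      proof -
        have "0 \<le> 2 powr (- (real ?n / 2))" "0 \<le> K / 2 ^ r" using K by auto
        then show ?thesis using \<delta> by linarith
      qed
      finally have "measure_pmf.prob ?S {[]} \<le> \<epsilon> / 2" .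
      then have "(1/2 + \<epsilon>) - \<epsilon> / 2 \<le> measure_pmf.expectation ?S (\<lambda>F. accept_prob Q (poly u) (enc_sparsify k I rs F))"
        using \<epsilon> good sat by (intro expectation_subs_bounds(2)[where B = "{[]}"] accept_prob_bounds) auto
      then show "1/2 + \<epsilon> / 2 \<le> accept_prob P (poly p) x" unfolding acc_x by simp
    next
      assume unsat: "at_most_satisfiable I (s ?n)"
      let ?B = "{F. F = [] \<or> \<not> at_most_satisfiable (sparsify k I F) (64 / \<alpha> ?n)}"
      have "measure_pmf.prob ?S ?B \<le> exp (- (real ?n / 8)) + 2 powr (- (real ?n / 2)) + 8 * real k * (2 ^ k) ^ (k - 1) / 2 ^ r"
        using pb(5)[OF r(2)] pb(3) I'(4)
        by (intro prob_sparsify_unsound[OF I'(1-3) unsat es assms(1) r pb(1,4)]) auto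
      then have "measure_pmf.prob ?S ?B \<le> \<epsilon> / 2" using \<delta> by (simp add: K_def)
      then have "measure_pmf.expectation ?S (\<lambda>F. accept_prob Q (poly u) (enc_sparsify k I rs F)) \<le> (1/2 - \<epsilon>) + \<epsilon> / 2"
        using \<epsilon> good by (intro expectation_subs_bounds(1)[where B = ?B] accept_prob_bounds) auto
      then show "accept_prob P (poly p) x \<le> 1/2 - \<epsilon> / 2" unfolding acc_x by simp
    qed
  qed
  have "rand_polytime_distinguishable
      {I \<in> regular_instances d q. all_satisfiable I}
      {I \<in> regular_instances d q. at_most_satisfiable I (s (num_vertices I))}"
    unfolding rand_polytime_distinguishable_def
    using P \<epsilon>(1) main by (intro exI[of _ P] exI[of _ p] exI[of _ "\<epsilon> / 2"] exI[of _ n1]) auto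
  with assms(2) show False by blast
qed simp

end
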